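(* Let $0<\beta\le1$ and $0<s<1$. (i) Let $u\in C^{0,\beta}_h$ and $2s<\beta$. Then $(-\Delta_h)^su\in C^{0,\beta-2s}_h$ and $$\|(-\Delta_h)^su\|_{C^{0,\beta-2s}_h}\le C\|u\|_{C^{0,\beta}_h}.$$ (ii) Let $u\in C^{1,\beta}_h$ and $2s<\beta$. Then $(-\Delta_h)^su\in C^{1,\beta-2s}_h$ and $$\|(-\Delta_h)^su\|_{C^{1,\beta-2s}_h}\le C\|u\|_{C^{1,\beta}_h}.$$ (iii) Let $u\in C^{1,\beta}_h$ and $\beta<2s<1+\beta$. Then $(-\Delta_h)^su\in C^{0,\beta-2s+1}_h$ and $$\|(-\Delta_h)^su\|_{C^{0,\beta-2s+1}_h}\le C\|u\|_{C^{1,\beta}_h}.$$ (iv) Let $k\in\mathbb{N}_0$, $u\in C^{k,\beta}_h$ and assume that $k+\beta-2s$ is not an integer, with $2s<k+\beta$. Then $(-\Delta_h)^su\in C^{l,\gamma}_h$, where $l$ is the integer part of $k+\beta-2s$ and $\gamma=k+\beta-2s-l$. The constants $C>0$ above are independent of $h>0$ and $u$.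
   Context: For $h>0$, $\mathbb{Z}_h=\{hj:j\in\mathbb{Z}\}$; a function on $\mathbb{Z}_h$ is written as a sequence $u_j$, $j\in\mathbb{Z}$. The discrete Laplacian is $\Delta_hu_j=\frac{1}{h^2}(u_{j+1}-2u_j+u_{j-1})$. Its heat semigroup is $e^{t\Delta_h}u_j=\sum_{m\in\mathbb{Z}}G(j-m,\tfrac{t}{h^2})u_m$, $t\ge0$, where $G(m,t)=e^{-2t}I_m(2t)$ and $I_m$ is the modified Bessel function of the first kind of order $m\in\mathbb{Z}$ (this is the solution $w_j(t)$ of $\partial_tw_j=\Delta_hw_j$, $w_j(0)=u_j$). For $0<s<1$, $$(-\Delta_h)^su_j=\frac{1}{\Gamma(-s)}\int_0^\infty\big(e^{t\Delta_h}u_j-u_j\big)\frac{dt}{t^{1+s}}.$$ Difference operators: $D_+u_j=\frac{u_{j+1}-u_j}{h}$, $D_-u_j=\frac{u_j-u_{j-1}}{h}$, and $D_{+,-}^{\gamma,\eta}u_j=D_+^\gamma D_-^\eta u_j$ for $\gamma,\eta\in\mathbb{N}_0$, where $D_\pm^k$ is $D_\pm$ applied $k$ times and $D_\pm^0$ is the identity. Discrete Hölder spaces: for $0<\beta\le1$ and $k\in\mathbb{N}_0$, a bounded function $u:\mathbb{Z}_h\to\mathbb{R}$ belongs to $C_h^{k,\beta}$ if $$[D_{+,-}^{\gamma,\eta}u]_{C_h^{0,\beta}}:=\sup_{m\ne j}\frac{|D_{+,-}^{\gamma,\eta}u_j-D_{+,-}^{\gamma,\eta}u_m|}{h^\beta|j-m|^\beta}<\infty$$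 for each pair $\gamma,\eta\in\mathbb{N}_0$ with $\gamma+\eta=k$. The norm is $$\|u\|_{C_h^{k,\beta}}:=\max_{\gamma+\eta\le k}\sup_{m\in\mathbb{Z}}|D_{+,-}^{\gamma,\eta}u_m|+\max_{\gamma+\eta=k}[D_{+,-}^{\gamma,\eta}u]_{C_h^{0,\beta}}.$$ *)

theory Defs
  imports "HOL-Analysis.Analysis"
begin

text \<open>A function on the mesh \<open>h\<int>\<close> is encoded by its sequence of values, of type
  \<^typ>\<open>int \<Rightarrow> real\<close>; the mesh size \<open>h\<close> is an explicit argument of every operator
  that depends on it.\<close>

definition bessel_I :: "int \<Rightarrow> real \<Rightarrow> real" where
  \<comment> \<open>Modified Bessel function of the first kind of integer order:
     \<open>\<Sum>k. (z/2)^(2k+m) / (k! \<Gamma>(m+k+1))\<close>. Since \<open>rGamma = 1/\<Gamma>\<close> vanishes at the poles of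
     \<open>\<Gamma>\<close>, for \<open>m < 0\<close> the terms with \<open>k < -m\<close> drop out, also at \<open>z = 0\<close>.\<close>
  "bessel_I m z =
     (\<Sum>k. rGamma (real_of_int m + real k + 1) / fact k * (z / 2) powi (2 * int k + m))"

definition heat_kernel :: "int \<Rightarrow> real \<Rightarrow> real" where
  "heat_kernel m t = exp (- 2 * t) * bessel_I m (2 * t)"

definition heat_semigroup :: "real \<Rightarrow> real \<Rightarrow> (int \<Rightarrow> real) \<Rightarrow> int \<Rightarrow> real" where
  "heat_semigroup h t u j = (\<Sum>\<^sub>\<infinity>m\<in>UNIV. heat_kernel (j - m) (t / h\<^sup>2) * u m)"

definition frac_laplacian :: "real \<Rightarrow> real \<Rightarrow> (int \<Rightarrow> real) \<Rightarrow> int \<Rightarrow> real" where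
  \<comment> \<open>\<open>(-\<Delta>\<^sub>h)\<^sup>s u\<close>. For bounded \<open>u\<close> the sum above converges absolutely, and this Lebesgue
     integral too: the difference is \<open>O(t)\<close> as \<open>t \<rightarrow> 0\<close> and bounded as \<open>t \<rightarrow> \<infinity>\<close>.\<close>
  "frac_laplacian h s u j =
     1 / Gamma (- s) *
       (LINT t:{0<..}|lborel. (heat_semigroup h t u j - u j) / t powr (1 + s))"

definition D_plus :: "real \<Rightarrow> (int \<Rightarrow> real) \<Rightarrow> int \<Rightarrow> real" where
  "D_plus h u j = (u (j + 1) - u j) / h"

definition D_minus :: "real \<Rightarrow> (int \<Rightarrow> real) \<Rightarrow> int \<Rightarrow> real" where
  "D_minus h u j = (u j - u (j - 1)) / h"

definition D_mixed :: "real \<Rightarrow> nat \<Rightarrow> nat \<Rightarrow> (int \<Rightarrow> real) \<Rightarrow> int \<Rightarrow> real" where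
  "D_mixed h \<gamma> \<eta> u = (D_plus h ^^ \<gamma>) ((D_minus h ^^ \<eta>) u)"

definition holder_quotient :: "real \<Rightarrow> real \<Rightarrow> (int \<Rightarrow> real) \<Rightarrow> int \<Rightarrow> int \<Rightarrow> real" where
  "holder_quotient h \<beta> v j m =
     \<bar>v j - v m\<bar> / (h powr \<beta> * \<bar>real_of_int (j - m)\<bar> powr \<beta>)"

definition holder_seminorm :: "real \<Rightarrow> real \<Rightarrow> (int \<Rightarrow> real) \<Rightarrow> real" where
  "holder_seminorm h \<beta> v = (SUP (j, m)\<in>{(j, m). m \<noteq> j}. holder_quotient h \<beta> v j m)"

definition holder_space :: "real \<Rightarrow> nat \<Rightarrow> real \<Rightarrow> (int \<Rightarrow> real) set" where
  \<comment> \<open>\<open>C\<^sub>h\<^sup>k\<^sup>,\<^sup>\<beta>\<close>; finiteness of the supremum is expressed by \<^const>\<open>bdd_above\<close>.\<close>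
  "holder_space h k \<beta> =
     {u. bounded (range u) \<and>
         (\<forall>\<gamma> \<eta>. \<gamma> + \<eta> = k \<longrightarrow>
            bdd_above ((\<lambda>(j, m). holder_quotient h \<beta> (D_mixed h \<gamma> \<eta> u) j m)
                         ` {(j, m). m \<noteq> j}))}"

definition holder_norm :: "real \<Rightarrow> nat \<Rightarrow> real \<Rightarrow> (int \<Rightarrow> real) \<Rightarrow> real" where
  \<comment> \<open>Meaningful on \<^const>\<open>holder_space\<close> with \<open>h > 0\<close>: there all suprema are finite, because
     differences of a bounded sequence are bounded.\<close>
  "holder_norm h k \<beta> u =
     (MAX (\<gamma>, \<eta>)\<in>{(\<gamma>, \<eta>). \<gamma> + \<eta> \<le> k}. SUP m. \<bar>D_mixed h \<gamma> \<eta> u m\<bar>) +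
     (MAX (\<gamma>, \<eta>)\<in>{(\<gamma>, \<eta>). \<gamma> + \<eta> = k}. holder_seminorm h \<beta> (D_mixed h \<gamma> \<eta> u))"

end

theory Submission
  imports Defs "HOL-Probability.Product_PMF"
begin

text \<open>The estimates are read off from the heat semigroup \<open>e\<^sup>t\<^sup>\<Delta>\<close> itself. The heat kernel
  at time \<open>\<tau>\<close> is the distribution of the difference of two independent Poisson variables of rate
  \<open>\<tau>\<close> (\<open>heat_kernel_eq_pmf\<close>). Hence \<open>e\<^sup>t\<^sup>\<Delta> u\<close> at \<open>j\<close> is the expectation of \<open>u (j - X)\<close> for a
  symmetric integer variable \<open>X\<close> with \<open>\<tau> = t / h\<^sup>2\<close>. Its second moment is of order \<open>\<tau>\<close>, so
  the expectation of \<open>(h * \<bar>X\<bar>) powr \<alpha>\<close> is at most \<open>5 * t powr (\<alpha> / 2)\<close> for \<open>0 < \<alpha> \<le> 2\<close>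
  (\<open>skellam_moment\<close>), with a constant that does not see \<open>h\<close>. By symmetry, if the second
  differences of \<open>u\<close> are of order \<open>\<alpha>\<close>, then \<open>e\<^sup>t\<^sup>\<Delta> u - u\<close> is of size \<open>t powr (\<alpha> / 2)\<close>
  (\<open>heat_semigroup_increment_le\<close>).

  To bound the fractional Laplacian at a point, split the time integral at \<open>t = 1\<close>; to bound its
  increment between two points at distance \<open>r\<close>, split at \<open>t = r\<^sup>2\<close> (\<open>frac_laplacian_diff_le\<close>).
  For small times both values of \<open>e\<^sup>t\<^sup>\<Delta> u - u\<close> are small. For large times the two values are
  close to each other. If \<open>u\<close> is \<open>\<beta>\<close>-Hoelder with \<open>2 * s < \<beta>\<close>, they differ by a multiple of
  \<open>r powr \<beta>\<close>; if \<open>\<beta> < 2 * s < 1 + \<beta>\<close> and the slope of \<open>u\<close> is \<open>\<beta>\<close>-Hoelder, they differ by a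
  multiple of \<open>r * t powr (\<beta> / 2)\<close>. In all cases the powers of \<open>r\<close> match. This gives the first and third
  claim; the second follows from the first because the fractional Laplacian commutes with
  difference operators (\<open>frac_laplacian_D_mixed\<close>).

  The fourth claim asserts no estimate. For fixed \<open>h\<close> the fractional Laplacian maps bounded
  functions to bounded ones, and on a mesh every bounded function belongs to all Hoelder spaces
  (\<open>bounded_in_holder_space\<close>).\<close>

section \<open>The discrete heat kernel as a probability distribution\<close>

text \<open>The difference of two independent Poisson variables of the same rate. This is the position at
  time \<open>\<tau>\<close> of the continuous-time random walk that jumps by \<open>\<plusminus>1\<close>, each at rate \<open>1\<close>.\<close>

definition skellam_pmf :: "real \<Rightarrow> int pmf" where
  "skellam_pmf \<tau> =
     map_pmf (\<lambda>(a, b). int a - int b) (pair_pmf (poisson_pmf \<tau>) (poisson_pmf \<tau>))"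

lemma expectation_pmf_nat_sums:
  fixes p :: "nat pmf" and g :: "nat \<Rightarrow> real"
  assumes "integrable (measure_pmf p) g"
  shows "(\<lambda>n. pmf p n * g n) sums measure_pmf.expectation p g"
proof -
  have "integrable (count_space UNIV) (\<lambda>n. pmf p n * g n)"
    using assms by (simp add: measure_pmf_eq_density integrable_density)
  from sums_integral_count_space_nat[OF this] show ?thesis
    by (simp add: measure_pmf_eq_density integral_density)
qed

lemma integrable_pmf_bounded:
  fixes p :: "'a pmf" and g :: "'a \<Rightarrow> real"
  assumes "\<And>x. \<bar>g x\<bar> \<le> B"
  shows "integrable (measure_pmf p) g"
  by (rule measure_pmf.integrable_const_bound[where B = B]) (use assms in auto)

text \<open>The factor \<open>rGamma\<close> in the Bessel series is the reciprocal factorial when the Poisson variable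
  can reach \<open>m + b\<close>, and vanishes when \<open>m + b\<close> is negative; so both sides drop the same terms.\<close>

lemma pmf_poisson_shift:
  assumes "0 < \<tau>"
  shows "pmf (map_pmf (\<lambda>a. int a - int b) (poisson_pmf \<tau>)) m =
           exp (- \<tau>) * (rGamma (real_of_int m + real b + 1) * \<tau> powi (int b + m))"
proof (cases "0 \<le> m + int b")
  case True
  then have m: "m = int (nat (m + int b)) - int b" by simp
  have "pmf (map_pmf (\<lambda>a. int a - int b) (poisson_pmf \<tau>)) m = pmf (poisson_pmf \<tau>) (nat (m + int b))"
    by (subst m, rule pmf_map_inj') (auto simp: inj_on_def)
  moreover have "rGamma (real_of_int m + real b + 1) = inverse (fact (nat (m + int b)))"
    using True rGamma_of_int[of "m + int b + 1", where 'a = real] by simp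
  moreover have "\<tau> powi (int b + m) = \<tau> ^ nat (m + int b)"
    using True by (simp add: power_int_def add.commute)
  ultimately show ?thesis using assms by (simp add: divide_inverse mult_ac)
next
  case False
  then have "m \<notin> range (\<lambda>a. int a - int b)" by auto
  then have "pmf (map_pmf (\<lambda>a. int a - int b) (poisson_pmf \<tau>)) m = 0"
    by (intro pmf_map_outside) auto
  moreover have "rGamma (real_of_int m + real b + 1) = 0"
    using False rGamma_of_int[of "m + int b + 1", where 'a = real] by simp
  ultimately show ?thesis by simp
qed

text \<open>Conditioning the Skellam distribution on the subtracted Poisson variable \<open>b\<close> produces
  \<open>\<Sum>b. e\<^sup>-\<^sup>\<tau> \<tau>\<^sup>b / b! \<cdot> e\<^sup>-\<^sup>\<tau> \<tau>\<^sup>b\<^sup>+\<^sup>m / (b + m)!\<close>, which is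
  the Bessel series termwise. The unit mass, the symmetry and the moments of the heat kernel become
  those of a random variable.\<close>

lemma heat_kernel_eq_pmf:
  assumes "0 < \<tau>"
  shows "heat_kernel m \<tau> = pmf (skellam_pmf \<tau>) m"
proof -
  let ?P = "poisson_pmf \<tau>"
  let ?g = "\<lambda>b. pmf (map_pmf (\<lambda>a. int a - int b) ?P) m"
  have "skellam_pmf \<tau> = bind_pmf ?P (\<lambda>b. map_pmf (\<lambda>a. int a - int b) ?P)"
    unfolding skellam_pmf_def pair_pmf_def map_bind_pmf map_return_pmf
    by (subst bind_commute_pmf) (simp add: map_pmf_def bind_assoc_pmf bind_return_pmf)
  then have "pmf (skellam_pmf \<tau>) m = measure_pmf.expectation ?P ?g"
    by (simp add: pmf_bind)
  moreover have "(\<lambda>b. pmf ?P b * ?g b) sums measure_pmf.expectation ?P ?g"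
    by (intro expectation_pmf_nat_sums integrable_pmf_bounded[where B = 1]) (simp add: pmf_le_1)
  moreover have "pmf ?P b * ?g b =
      exp (- 2 * \<tau>) * (rGamma (real_of_int m + real b + 1) / fact b * (2 * \<tau> / 2) powi (2 * int b + m))" for b
  proof -
    have "\<tau> powi (2 * int b + m) = \<tau> ^ b * \<tau> powi (int b + m)"
      using assms power_int_add[of \<tau> "int b" "int b + m"] by (simp add: algebra_simps)
    moreover have "exp (- 2 * \<tau>) = exp (-\<tau>) * exp (-\<tau>)"
      by (simp flip: exp_add)
    ultimately show ?thesis using assms by (simp add: pmf_poisson_shift field_simps)
  qed
  ultimately have "(\<lambda>b. exp (- 2 * \<tau>) * (rGamma (real_of_int m + real b + 1) / fact b * (2 * \<tau> / 2) powi (2 * int b + m)))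
      sums pmf (skellam_pmf \<tau>) m" by simp
  from sums_mult[OF this, of "exp (2 * \<tau>)"]
  have "(\<lambda>b. rGamma (real_of_int m + real b + 1) / fact b * (2 * \<tau> / 2) powi (2 * int b + m))
      sums (exp (2 * \<tau>) * pmf (skellam_pmf \<tau>) m)"
    by (simp flip: mult.assoc exp_add)
  then have "bessel_I m (2 * \<tau>) = exp (2 * \<tau>) * pmf (skellam_pmf \<tau>) m"
    unfolding bessel_I_def by (rule sums_unique[symmetric])
  then show ?thesis by (simp add: heat_kernel_def flip: mult.assoc exp_add)
qed

lemma map_uminus_skellam: "map_pmf uminus (skellam_pmf \<tau>) = skellam_pmf \<tau>"
  unfolding skellam_pmf_def
  by (subst (2) pair_commute_pmf) (simp add: map_pmf_comp case_prod_unfold)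

text \<open>The first two moments come from the index shift \<open>e (n + 1) \<cdot> (n + 1) = \<tau> \<cdot> e n\<close> for
  \<open>e n = \<tau>\<^sup>n / n!\<close>.\<close>

lemma poisson_variance_sums:
  fixes \<tau> :: real
  shows "(\<lambda>n. \<tau> ^ n / fact n * exp (- \<tau>) * (real n - \<tau>)\<^sup>2) sums \<tau>"
proof -
  define e where "e = (\<lambda>n. \<tau> ^ n / fact n)"
  have e: "e sums exp \<tau>"
    using exp_converges[of \<tau>] unfolding e_def by (simp add: scaleR_conv_of_real field_simps)
  have suc: "e (Suc n) * real (Suc n) = \<tau> * e n" for n
    unfolding e_def fact_Suc power_Suc by (simp del: of_nat_Suc)
  have e1: "(\<lambda>n. e n * real n) sums (\<tau> * exp \<tau>)"
    by (subst sums_Suc_iff[symmetric, where f = "\<lambda>n. e n * real n", simplified])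
       (use sums_mult[OF e, of \<tau>] suc in simp)
  have e2: "(\<lambda>n. e n * (real n)\<^sup>2) sums (\<tau> * (\<tau> * exp \<tau> + exp \<tau>))"
  proof -
    have "(\<lambda>n. \<tau> * (e n * real n + e n)) sums (\<tau> * (\<tau> * exp \<tau> + exp \<tau>))"
      by (intro sums_mult sums_add e e1)
    moreover have "\<tau> * (e n * real n + e n) = e (Suc n) * (real (Suc n))\<^sup>2" for n
      unfolding power2_eq_square mult.assoc[symmetric] suc by (simp add: algebra_simps)
    ultimately show ?thesis
      using sums_Suc_iff[of "\<lambda>n. e n * (real n)\<^sup>2"] by simp
  qed
  have "(\<lambda>n. exp (- \<tau>) * ((e n * (real n)\<^sup>2 - 2 * \<tau> * (e n * real n)) + \<tau>\<^sup>2 * e n))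
      sums (exp (- \<tau>) * ((\<tau> * (\<tau> * exp \<tau> + exp \<tau>) - 2 * \<tau> * (\<tau> * exp \<tau>)) + \<tau>\<^sup>2 * exp \<tau>))"
    by (intro sums_mult sums_add sums_diff e e1 e2)
  moreover have "exp (- \<tau>) * ((\<tau> * (\<tau> * exp \<tau> + exp \<tau>) - 2 * \<tau> * (\<tau> * exp \<tau>)) + \<tau>\<^sup>2 * exp \<tau>) = \<tau>"
    by (simp add: algebra_simps power2_eq_square exp_minus)
  moreover have "exp (- \<tau>) * ((e n * (real n)\<^sup>2 - 2 * \<tau> * (e n * real n)) + \<tau>\<^sup>2 * e n) =
      \<tau> ^ n / fact n * exp (- \<tau>) * (real n - \<tau>)\<^sup>2" for n
    unfolding e_def by (simp add: algebra_simps power2_eq_square add_divide_distrib)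
  ultimately show ?thesis by simp
qed

lemma nn_integral_poisson_variance:
  assumes "0 < \<tau>"
  shows "(\<integral>\<^sup>+n. ennreal ((real n - \<tau>)\<^sup>2) \<partial>poisson_pmf \<tau>) = ennreal \<tau>"
proof -
  have "(\<integral>\<^sup>+n. ennreal ((real n - \<tau>)\<^sup>2) \<partial>poisson_pmf \<tau>) =
      (\<integral>\<^sup>+n. ennreal (\<tau> ^ n / fact n * exp (- \<tau>) * (real n - \<tau>)\<^sup>2) \<partial>count_space UNIV)"
    using assms by (simp add: nn_integral_measure_pmf flip: ennreal_mult')
  also have "\<dots> = (\<Sum>n. ennreal (\<tau> ^ n / fact n * exp (- \<tau>) * (real n - \<tau>)\<^sup>2))"
    by (rule nn_integral_count_space_nat)
  also have "\<dots> = ennreal \<tau>"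
    using assms by (intro sums_unique[symmetric] sums_ennreal[THEN iffD2] poisson_variance_sums) auto
  finally show ?thesis .
qed

text \<open>The exact second moment is \<open>2 \<cdot> \<tau>\<close>. The cruder constant comes from
  \<open>(a - b)\<^sup>2 \<le> 2 (a - \<tau>)\<^sup>2 + 2 (b - \<tau>)\<^sup>2\<close>, which reduces the estimate to the variances of the
  marginals.\<close>

lemma nn_integral_skellam_square_le:
  assumes "0 < \<tau>"
  shows "(\<integral>\<^sup>+x. ennreal ((real_of_int x)\<^sup>2) \<partial>skellam_pmf \<tau>) \<le> ennreal (4 * \<tau>)"
proof -
  let ?P = "poisson_pmf \<tau>"
  let ?v = "\<lambda>n. ennreal ((real n - \<tau>)\<^sup>2)"
  have *: "ennreal ((real_of_int (int a - int b))\<^sup>2) \<le> 2 * ?v a + 2 * ?v b" for a b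
  proof -
    have "(real_of_int (int a - int b))\<^sup>2 \<le> 2 * (real a - \<tau>)\<^sup>2 + 2 * (real b - \<tau>)\<^sup>2"
      using zero_le_power2[of "real a + real b - 2 * \<tau>"]
      by (simp add: power2_eq_square algebra_simps)
    then show ?thesis
      by (simp add: ennreal_leI flip: ennreal_plus ennreal_mult' ennreal_numeral)
  qed
  have "(\<integral>\<^sup>+x. ennreal ((real_of_int x)\<^sup>2) \<partial>skellam_pmf \<tau>) =
      (\<integral>\<^sup>+a. \<integral>\<^sup>+b. ennreal ((real_of_int (int a - int b))\<^sup>2) \<partial>?P \<partial>?P)"
    unfolding skellam_pmf_def by (simp add: nn_integral_pair_pmf')
  also have "\<dots> \<le> (\<integral>\<^sup>+a. \<integral>\<^sup>+b. (2 * ?v a + 2 * ?v b) \<partial>?P \<partial>?P)"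
    by (intro nn_integral_mono *)
  also have "\<dots> = 2 * ennreal \<tau> + 2 * ennreal \<tau>"
    by (simp add: nn_integral_add nn_integral_cmult nn_integral_poisson_variance[OF assms])
  also have "\<dots> = ennreal (4 * \<tau>)"
    using assms by (simp flip: ennreal_plus ennreal_mult' ennreal_numeral)
  finally show ?thesis .
qed

text \<open>Below the threshold \<open>r\<close> the first summand dominates, above it the second one. Choosing \<open>r\<close>
  according to the second moment of a variable then bounds all its lower moments.\<close>

lemma powr_le_interpolate_square:
  fixes x r :: real
  assumes "0 < r" "0 \<le> x" "0 < \<alpha>" "\<alpha> \<le> 2"
  shows "x powr \<alpha> \<le> r powr \<alpha> + r powr (\<alpha> - 2) * x\<^sup>2"
proof (cases "x \<le> r")
  case True
  then have "x powr \<alpha> \<le> r powr \<alpha>" using assms by (intro powr_mono2) auto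
  moreover have "0 \<le> r powr (\<alpha> - 2) * x\<^sup>2" by simp
  ultimately show ?thesis by linarith
next
  case False
  then have x: "0 < x" using assms by simp
  have "x powr \<alpha> = x powr (\<alpha> - 2) * x powr 2"
    by (subst powr_add[symmetric]) simp
  also have "\<dots> = x powr (\<alpha> - 2) * x\<^sup>2" using x by (simp add: powr_numeral)
  also have "\<dots> \<le> r powr (\<alpha> - 2) * x\<^sup>2"
    using False assms by (intro mult_right_mono powr_mono2') auto
  finally show ?thesis by (simp add: add_increasing)
qed

text \<open>The interpolation threshold is the standard deviation scale \<open>\<surd>\<tau>\<close>, for which both summands
  scale like \<open>\<tau> powr (\<alpha> / 2)\<close>. This is the parabolic scaling on which all later exponents rest.\<close>

lemma skellam_moment:
  assumes "0 < \<tau>" "0 < \<alpha>" "\<alpha> \<le> 2"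
  shows "integrable (skellam_pmf \<tau>) (\<lambda>x. \<bar>real_of_int x\<bar> powr \<alpha>)"
    and "measure_pmf.expectation (skellam_pmf \<tau>) (\<lambda>x. \<bar>real_of_int x\<bar> powr \<alpha>) \<le> 5 * \<tau> powr (\<alpha> / 2)"
proof -
  let ?W = "skellam_pmf \<tau>"
  have fin: "(\<integral>\<^sup>+x. ennreal ((real_of_int x)\<^sup>2) \<partial>?W) < \<infinity>"
    using nn_integral_skellam_square_le[OF assms(1)] by (rule le_less_trans) simp
  then have int2: "integrable ?W (\<lambda>x. (real_of_int x)\<^sup>2)"
    by (intro integrableI_nonneg) auto
  have E2: "measure_pmf.expectation ?W (\<lambda>x. (real_of_int x)\<^sup>2) \<le> 4 * \<tau>"
    using nn_integral_skellam_square_le[OF assms(1)] assms(1)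
    by (subst (asm) nn_integral_eq_integral[OF int2]) auto
  let ?r = "sqrt \<tau>"
  let ?G = "\<lambda>x::int. ?r powr \<alpha> + ?r powr (\<alpha> - 2) * (real_of_int x)\<^sup>2"
  have le: "\<bar>real_of_int x\<bar> powr \<alpha> \<le> ?G x" for x :: int
    using powr_le_interpolate_square[of ?r "\<bar>real_of_int x\<bar>" \<alpha>] assms by simp
  have intG: "integrable ?W ?G" using int2 by simp
  show int: "integrable ?W (\<lambda>x. \<bar>real_of_int x\<bar> powr \<alpha>)"
    by (rule Bochner_Integration.integrable_bound[OF intG]) (use le in \<open>auto intro: order_trans\<close>)
  have "measure_pmf.expectation ?W (\<lambda>x. \<bar>real_of_int x\<bar> powr \<alpha>) \<le> measure_pmf.expectation ?W ?G"
    by (intro integral_mono int intG le)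
  also have "\<dots> = ?r powr \<alpha> + ?r powr (\<alpha> - 2) * measure_pmf.expectation ?W (\<lambda>x. (real_of_int x)\<^sup>2)"
    using int2 by simp
  also have "\<dots> \<le> ?r powr \<alpha> + ?r powr (\<alpha> - 2) * (4 * \<tau>)"
    using E2 by (intro add_left_mono mult_left_mono) auto
  also have "\<dots> = 5 * \<tau> powr (\<alpha> / 2)"
  proof -
    have "?r powr \<alpha> = \<tau> powr (\<alpha> / 2)" for \<alpha>
      using assms by (simp add: powr_half_sqrt[symmetric] powr_powr)
    moreover have "\<tau> powr ((\<alpha> - 2) / 2) * \<tau> = \<tau> powr (\<alpha> / 2)"
      using assms powr_add[of \<tau> "(\<alpha> - 2) / 2" 1] by (simp add: diff_divide_distrib)
    ultimately show ?thesis by (simp add: algebra_simps)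
  qed
  finally show "measure_pmf.expectation ?W (\<lambda>x. \<bar>real_of_int x\<bar> powr \<alpha>) \<le> 5 * \<tau> powr (\<alpha> / 2)" .
qed

section \<open>The discrete heat semigroup\<close>

lemma heat_semigroup_summable:
  assumes "0 < h" "0 < t" "\<And>i. \<bar>u i\<bar> \<le> N"
  shows "Infinite_Set_Sum.abs_summable_on (\<lambda>x. pmf (skellam_pmf (t / h\<^sup>2)) x * u (j - x)) UNIV"
proof -
  let ?W = "skellam_pmf (t / h\<^sup>2)"
  have "integrable (measure_pmf ?W) (\<lambda>x. u (j - x))"
    using assms(3) by (rule integrable_pmf_bounded)
  then show ?thesis
    unfolding Infinite_Set_Sum.abs_summable_on_def
    by (simp add: measure_pmf_eq_density integrable_density)
qed

lemma heat_semigroup_eq_expectation: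
  assumes "0 < h" "0 < t" "\<And>i. \<bar>u i\<bar> \<le> N"
  shows "heat_semigroup h t u j = measure_pmf.expectation (skellam_pmf (t / h\<^sup>2)) (\<lambda>x. u (j - x))"
proof -
  let ?W = "skellam_pmf (t / h\<^sup>2)"
  have "heat_semigroup h t u j = (\<Sum>\<^sub>\<infinity>m. pmf ?W (j - m) * u m)"
    unfolding heat_semigroup_def using assms by (simp add: heat_kernel_eq_pmf)
  also have "\<dots> = (\<Sum>\<^sub>\<infinity>x. pmf ?W x * u (j - x))"
    by (rule infsum_reindex_bij_witness[of _ "\<lambda>x. j - x" "\<lambda>m. j - m"]) auto
  also have "\<dots> = infsetsum (\<lambda>x. pmf ?W x * u (j - x)) UNIV"
    by (rule infsetsum_infsum[symmetric, OF heat_semigroup_summable[OF assms]])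
  finally show ?thesis by (simp add: pmf_expectation_eq_infsetsum)
qed

lemma borel_measurable_heat_kernel [measurable]: "heat_kernel m \<in> borel_measurable borel"
proof -
  have "(\<lambda>z::real. z powi n) \<in> borel_measurable borel" for n
    by (cases "0 \<le> n") (simp_all add: power_int_def)
  then have [measurable]: "(\<lambda>t::real. (2 * t / 2) powi n) \<in> borel_measurable borel" for n
    by simp
  show ?thesis
    unfolding heat_kernel_def bessel_I_def by measurable
qed

text \<open>For positive times the semigroup is a convergent series of heat kernels, and these are
  measurable in time; enumerating the integers turns the unordered sum into a series.\<close>

lemma set_borel_measurable_heat_semigroup:
  assumes "0 < h" "\<And>i. \<bar>u i\<bar> \<le> N"
  shows "set_borel_measurable lborel {0<..} (\<lambda>t. heat_semigroup h t u j)"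
proof -
  let ?F = "\<lambda>t. \<Sum>n. heat_kernel (j - int_decode n) (t / h\<^sup>2) * u (int_decode n)"
  have eq: "heat_semigroup h t u j = ?F t" if "0 < t" for t
  proof -
    let ?f = "\<lambda>m. heat_kernel (j - m) (t / h\<^sup>2) * u m"
    have "Infinite_Set_Sum.abs_summable_on ?f UNIV \<longleftrightarrow>
        Infinite_Set_Sum.abs_summable_on (\<lambda>x. ?f (j - x)) UNIV"
      by (rule abs_summable_on_reindex_bij_betw[symmetric])
         (rule bij_betw_byWitness[where f' = "\<lambda>m. j - m"], auto)
    also have "(\<lambda>x. ?f (j - x)) = (\<lambda>x. pmf (skellam_pmf (t / h\<^sup>2)) x * u (j - x))"
      using assms(1) that by (simp add: heat_kernel_eq_pmf)
    finally have "Infinite_Set_Sum.abs_summable_on ?f UNIV"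
      using heat_semigroup_summable[OF assms(1) that assms(2)] by (rule iffD2)
    then have "?f summable_on UNIV"
      by (rule abs_summable_summable[OF abs_summable_equivalent[THEN iffD2]])
    then have "(?f has_sum heat_semigroup h t u j) UNIV"
      unfolding heat_semigroup_def by simp
    then have "((\<lambda>n. ?f (int_decode n)) has_sum heat_semigroup h t u j) UNIV"
      using has_sum_reindex_bij_betw[OF bij_int_decode, of ?f] by simp
    from has_sum_imp_sums[OF this] show ?thesis by (simp add: sums_iff)
  qed
  have "(\<lambda>t. indicator {0<..} t *\<^sub>R ?F t) \<in> borel_measurable lborel"
    by measurable
  also have "(\<lambda>t. indicator {0<..} t *\<^sub>R ?F t) = (\<lambda>t. indicator {0<..} t *\<^sub>R heat_semigroup h t u j)"
    using eq by (auto simp: fun_eq_iff indicator_def)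
  finally show ?thesis unfolding set_borel_measurable_def .
qed

lemma set_borel_measurable_increment:
  assumes "0 < h" "\<And>i. \<bar>u i\<bar> \<le> N"
  shows "set_borel_measurable lborel {0<..} (\<lambda>t. heat_semigroup h t u j - u j)"
  using set_borel_measurable_heat_semigroup[OF assms, where j = j]
  unfolding set_borel_measurable_def scaleR_right_diff_distrib by measurable

lemma expectation_abs_le:
  fixes p :: "'a pmf" and f g :: "'a \<Rightarrow> real"
  assumes "integrable (measure_pmf p) f" "integrable (measure_pmf p) g" "\<And>x. \<bar>f x\<bar> \<le> g x"
  shows "\<bar>measure_pmf.expectation p f\<bar> \<le> measure_pmf.expectation p g"
proof -
  have "\<bar>measure_pmf.expectation p f\<bar> \<le> measure_pmf.expectation p (\<lambda>x. \<bar>f x\<bar>)"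
    by (rule integral_abs_bound)
  also have "\<dots> \<le> measure_pmf.expectation p g"
    using assms by (intro integral_mono) auto
  finally show ?thesis .
qed

lemma heat_semigroup_diff_le:
  assumes "0 < h" "0 < t" "\<And>i. \<bar>u i\<bar> \<le> N" and "\<And>x. \<bar>u (j - x) - u (i - x)\<bar> \<le> B"
  shows "\<bar>heat_semigroup h t u j - heat_semigroup h t u i\<bar> \<le> B"
proof -
  let ?W = "skellam_pmf (t / h\<^sup>2)"
  have int: "integrable (measure_pmf ?W) (\<lambda>x. u (k - x))" for k
    using assms(3) by (rule integrable_pmf_bounded)
  have "\<bar>measure_pmf.expectation ?W (\<lambda>x. u (j - x) - u (i - x))\<bar> \<le> measure_pmf.expectation ?W (\<lambda>_. B)"
    by (intro expectation_abs_le) (use int assms in auto)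
  then show ?thesis
    using int by (simp add: heat_semigroup_eq_expectation[OF assms(1,2,3)])
qed

lemma heat_semigroup_abs_le:
  assumes "0 < h" "0 < t" "\<And>i. \<bar>u i\<bar> \<le> N"
  shows "\<bar>heat_semigroup h t u j\<bar> \<le> N"
proof -
  let ?W = "skellam_pmf (t / h\<^sup>2)"
  have int: "integrable (measure_pmf ?W) (\<lambda>x. u (j - x))"
    using assms(3) by (rule integrable_pmf_bounded)
  have "\<bar>measure_pmf.expectation ?W (\<lambda>x. u (j - x))\<bar> \<le> measure_pmf.expectation ?W (\<lambda>_. N)"
    by (intro expectation_abs_le) (use int assms in auto)
  then show ?thesis by (simp add: heat_semigroup_eq_expectation[OF assms])
qed

lemma heat_semigroup_D_plus:
  assumes "0 < h" "0 < t" "\<And>i. \<bar>u i\<bar> \<le> N"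
  shows "heat_semigroup h t (D_plus h u) j = D_plus h (heat_semigroup h t u) j"
proof -
  let ?W = "skellam_pmf (t / h\<^sup>2)"
  have int: "integrable (measure_pmf ?W) (\<lambda>x. u (k - x))" for k
    using assms(3) by (rule integrable_pmf_bounded)
  have b: "\<bar>D_plus h u i\<bar> \<le> (N + N) / h" for i
    using assms(1) assms(3)[of i] assms(3)[of "i + 1"]
    unfolding D_plus_def by (auto simp: abs_divide intro!: divide_right_mono)
  have e: "D_plus h u (j - x) = (u (j + 1 - x) - u (j - x)) / h" for x
    by (simp add: D_plus_def algebra_simps)
  have "heat_semigroup h t (D_plus h u) j =
      measure_pmf.expectation ?W (\<lambda>x. (u (j + 1 - x) - u (j - x)) / h)"
    unfolding heat_semigroup_eq_expectation[where u = "D_plus h u", OF assms(1,2) b] e ..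
  also have "\<dots> = D_plus h (heat_semigroup h t u) j"
    using int by (simp add: D_plus_def heat_semigroup_eq_expectation[OF assms])
  finally show ?thesis .
qed

text \<open>By symmetry of the walk, \<open>2 (e\<^sup>t\<^sup>\<Delta> u - u)\<close> is the expectation of the symmetric second
  difference of \<open>u\<close>. A second difference of order \<open>\<alpha>\<close> thus becomes a power \<open>\<alpha> / 2\<close> of time, with
  the mesh size cancelling. Working with second rather than first differences is what allows
  \<open>1 < \<alpha>\<close>.\<close>

lemma heat_semigroup_increment_le:
  assumes "0 < h" "0 < t" "\<And>i. \<bar>u i\<bar> \<le> N" "0 < \<alpha>" "\<alpha> \<le> 2"
    and "\<And>x. \<bar>u (j + x) + u (j - x) - 2 * u j\<bar> \<le> A * (h * \<bar>real_of_int x\<bar>) powr \<alpha>"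
  shows "\<bar>heat_semigroup h t u j - u j\<bar> \<le> 5 / 2 * A * t powr (\<alpha> / 2)"
proof -
  let ?W = "skellam_pmf (t / h\<^sup>2)"
  let ?E = "measure_pmf.expectation ?W"
  have \<tau>: "0 < t / h\<^sup>2" using assms by simp
  have "0 \<le> A * (h * \<bar>real_of_int 1\<bar>) powr \<alpha>"
    using assms(6)[of 1] by (rule order_trans[OF abs_ge_zero])
  then have A: "0 \<le> A" using assms(1) by (simp add: zero_le_mult_iff)
  have int: "integrable (measure_pmf ?W) (\<lambda>x. u (j - x))" "integrable (measure_pmf ?W) (\<lambda>x. u (j + x))"
    using assms(3) by (auto intro: integrable_pmf_bounded)
  have "?E (\<lambda>x. u (j + x)) = measure_pmf.expectation (map_pmf uminus ?W) (\<lambda>x. u (j - x))"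
    by simp
  then have sym: "?E (\<lambda>x. u (j + x)) = ?E (\<lambda>x. u (j - x))"
    by (simp only: map_uminus_skellam)
  have "2 * (heat_semigroup h t u j - u j) = ?E (\<lambda>x. u (j + x) + u (j - x) - 2 * u j)"
    using int sym by (simp add: heat_semigroup_eq_expectation[OF assms(1,2,3)])
  also have "\<bar>\<dots>\<bar> \<le> ?E (\<lambda>x. A * h powr \<alpha> * \<bar>real_of_int x\<bar> powr \<alpha>)"
    using assms(6) int skellam_moment(1)[OF \<tau> assms(4,5)] assms(1)
    by (intro expectation_abs_le) (auto simp: powr_mult mult.assoc)
  also have "\<dots> = A * h powr \<alpha> * ?E (\<lambda>x. \<bar>real_of_int x\<bar> powr \<alpha>)"
    by simp
  also have "\<dots> \<le> A * h powr \<alpha> * (5 * (t / h\<^sup>2) powr (\<alpha> / 2))"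
    using A by (intro mult_left_mono skellam_moment(2)[OF \<tau> assms(4,5)]) auto
  also have "\<dots> = 5 * A * t powr (\<alpha> / 2)"
  proof -
    have "(h\<^sup>2) powr (\<alpha> / 2) = h powr \<alpha>"
      using assms(1) by (simp add: powr_powr flip: powr_numeral)
    then show ?thesis using assms(1,2) by (simp add: powr_divide)
  qed
  finally show ?thesis by (simp only: abs_mult) simp
qed

section \<open>A two-scale bound for singular time integrals\<close>

lemma has_bochner_integral_of_has_integral:
  fixes f :: "real \<Rightarrow> real"
  assumes "(f has_integral I) S" "\<And>x. x \<in> S \<Longrightarrow> 0 \<le> f x"
    and [measurable]: "f \<in> borel_measurable borel" "S \<in> sets borel"
  shows "has_bochner_integral lborel (\<lambda>x. indicator S x * f x) I"
proof (rule has_bochner_integral_nn_integral)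
  show "0 \<le> I" using assms(1,2) by (rule has_integral_nonneg)
  show "(\<integral>\<^sup>+x. ennreal (indicator S x * f x) \<partial>lborel) = ennreal I"
    using nn_integral_has_integral_lebesgue[OF assms(2,1)] .
qed (use assms(2) in \<open>auto simp: indicator_def\<close>)

text \<open>The integrand of the fractional Laplacian is controlled by a higher power of \<open>t\<close> near the
  singularity at \<open>0\<close> and by a lower one near \<open>\<infinity>\<close>; the two are joined at a time \<open>R\<close> at choice.\<close>

lemma fractional_integral_bound:
  fixes f :: "real \<Rightarrow> real"
  assumes meas: "set_borel_measurable lborel {0<..} f"
    and "0 < R" "b < s" "s < a"
    and small: "\<And>t. 0 < t \<Longrightarrow> t \<le> R \<Longrightarrow> \<bar>f t\<bar> \<le> A * t powr a"
    and large: "\<And>t. R < t \<Longrightarrow> \<bar>f t\<bar> \<le> B * t powr b"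
  shows "set_integrable lborel {0<..} (\<lambda>t. f t / t powr (1 + s))"
    and "\<bar>LINT t:{0<..}|lborel. f t / t powr (1 + s)\<bar> \<le>
           A * R powr (a - s) / (a - s) + B * R powr (b - s) / (s - b)"
proof -
  let ?f = "\<lambda>t. f t / t powr (1 + s)"
  let ?G = "\<lambda>t. A * (indicator {0..R} t * t powr (a - s - 1)) + B * (indicator {R..} t * t powr (b - s - 1))"
  let ?I = "A * (R powr (a - s) / (a - s)) + B * (R powr (b - s) / (s - b))"
  have "has_bochner_integral lborel (\<lambda>t. indicator {0..R} t * t powr (a - s - 1)) (R powr (a - s) / (a - s))"
    using has_integral_powr_from_0[of "a - s - 1" R] assms
    by (intro has_bochner_integral_of_has_integral) auto
  moreover have "has_bochner_integral lborel (\<lambda>t. indicator {R..} t * t powr (b - s - 1)) (R powr (b - s) / (s - b))"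
  proof (intro has_bochner_integral_of_has_integral)
    have "- (R powr (b - s)) / (b - s) = R powr (b - s) / (s - b)"
      using assms(3) by (simp add: divide_simps) (simp add: algebra_simps)
    then show "((\<lambda>t. t powr (b - s - 1)) has_integral R powr (b - s) / (s - b)) {R..}"
      using has_integral_powr_to_inf[of "b - s - 1" R] assms by simp
  qed auto
  ultimately have G: "has_bochner_integral lborel ?G ?I"
    by (intro has_bochner_integral_add has_bochner_integral_mult_right)
  have "0 \<le> A * R powr a" using small[of R] \<open>0 < R\<close> by (simp add: order_trans[OF abs_ge_zero])
  then have A: "0 \<le> A" using \<open>0 < R\<close> by (simp add: zero_le_mult_iff)
  have "0 \<le> B * (R + 1) powr b" using large[of "R + 1"] by (simp add: order_trans[OF abs_ge_zero])
  then have B: "0 \<le> B" using \<open>0 < R\<close> by (simp add: zero_le_mult_iff)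
  have e: "t powr c / t powr (1 + s) = t powr (c - s - 1)" for t c :: real
    by (subst powr_diff[symmetric], rule arg_cong[where f = "\<lambda>e. t powr e"]) simp
  \<comment> \<open>The overlap of the two closed intervals at \<open>R\<close> is harmless because both summands are
     nonnegative, and at \<open>t = 0\<close> the majorant vanishes because \<open>0 powr c = 0\<close>.\<close>
  have le: "\<bar>indicator {0<..} t *\<^sub>R ?f t\<bar> \<le> ?G t" for t
  proof -
    consider "t \<le> 0" | "0 < t" "t \<le> R" | "R < t" by linarith
    then show ?thesis
    proof cases
      case 1
      then show ?thesis using A B \<open>0 < R\<close> by (auto simp: indicator_def)
    next
      case 2
      have "\<bar>?f t\<bar> \<le> A * t powr a / t powr (1 + s)"
        using small[OF 2] by (simp add: abs_divide divide_right_mono)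
      also have "\<dots> = A * t powr (a - s - 1)"
        unfolding e[symmetric] by simp
      finally show ?thesis using 2 B by (auto simp: indicator_def add_increasing2)
    next
      case 3
      have "\<bar>?f t\<bar> \<le> B * t powr b / t powr (1 + s)"
        using large[OF 3] by (simp add: abs_divide divide_right_mono)
      also have "\<dots> = B * t powr (b - s - 1)"
        unfolding e[symmetric] by simp
      finally show ?thesis using 3 \<open>0 < R\<close> by (auto simp: indicator_def)
    qed
  qed
  have [measurable]: "(\<lambda>t. indicator {0<..} t *\<^sub>R f t) \<in> borel_measurable lborel"
    using meas unfolding set_borel_measurable_def .
  have "(\<lambda>t. (indicator {0<..} t *\<^sub>R f t) / t powr (1 + s)) \<in> borel_measurable lborel"
    by measurable
  then have meas': "(\<lambda>t. indicator {0<..} t *\<^sub>R ?f t) \<in> borel_measurable lborel"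
    by (simp only: real_scaleR_def times_divide_eq_right)
  show int: "set_integrable lborel {0<..} ?f"
    unfolding set_integrable_def
  proof (rule Bochner_Integration.integrable_bound)
    show "integrable lborel ?G" using G by (simp only: has_bochner_integral_iff)
    show "AE t in lborel. norm (indicator {0<..} t *\<^sub>R ?f t) \<le> norm (?G t)"
      using order_trans[OF le abs_ge_self] by (intro AE_I2) (simp only: real_norm_def)
  qed (rule meas')
  have "\<bar>LINT t:{0<..}|lborel. ?f t\<bar> \<le> integral\<^sup>L lborel ?G"
    unfolding set_lebesgue_integral_def real_norm_def[symmetric]
    by (rule Bochner_Integration.integral_norm_bound_integral)
       (use int G le in \<open>simp_all only: set_integrable_def has_bochner_integral_iff real_norm_def\<close>)
  also have "\<dots> = ?I" using G by (simp only: has_bochner_integral_iff)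
  finally show "\<bar>LINT t:{0<..}|lborel. ?f t\<bar> \<le>
      A * R powr (a - s) / (a - s) + B * R powr (b - s) / (s - b)" by simp
qed

section \<open>The fractional Laplacian of bounded functions\<close>

text \<open>On a mesh of fixed size a bounded function has bounded differences of every order. The constant
  blows up as \<open>h\<close> tends to \<open>0\<close>, so this only serves to know that integrals converge and that the
  fractional Laplacian of a bounded function is bounded.\<close>

lemma second_difference_le_of_bounded:
  assumes "0 < h" "\<And>i. \<bar>u i\<bar> \<le> N"
  shows "\<bar>u (j + x) + u (j - x) - 2 * u j\<bar> \<le> 4 * N / h\<^sup>2 * (h * \<bar>real_of_int x\<bar>) powr 2"
proof (cases "x = 0")
  case False
  then have "1 \<le> \<bar>real_of_int x\<bar>" by linarith
  then have "1 \<le> \<bar>real_of_int x\<bar>\<^sup>2" by (rule one_le_power)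
  moreover have "0 \<le> N" using assms(2)[of 0] by linarith
  ultimately have "4 * N * 1 \<le> 4 * N * \<bar>real_of_int x\<bar>\<^sup>2" by (intro mult_left_mono) auto
  also have "\<dots> = 4 * N / h\<^sup>2 * (h * \<bar>real_of_int x\<bar>) powr 2"
    using assms(1) False by (simp add: powr_numeral power_mult_distrib)
  finally show ?thesis
    using assms(2)[of "j + x"] assms(2)[of "j - x"] assms(2)[of j] by linarith
qed (use assms in simp)

lemma frac_laplacian_integrable:
  assumes "0 < h" "0 < s" "s < 1" "\<And>i. \<bar>u i\<bar> \<le> N"
  shows "set_integrable lborel {0<..} (\<lambda>t. (heat_semigroup h t u j - u j) / t powr (1 + s))"
proof (rule fractional_integral_bound(1)[where R = 1 and a = 1 and b = 0])
  show "set_borel_measurable lborel {0<..} (\<lambda>t. heat_semigroup h t u j - u j)"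
    by (rule set_borel_measurable_increment[where u = u, OF assms(1,4)])
  fix t :: real assume "0 < t"
  from heat_semigroup_increment_le[where u = u, OF assms(1) \<open>0 < t\<close> assms(4) _ _
    second_difference_le_of_bounded[where u = u, OF assms(1,4)]]
  show "\<bar>heat_semigroup h t u j - u j\<bar> \<le> (5 / 2 * (4 * N / h\<^sup>2)) * t powr 1" by simp
next
  fix t :: real assume "1 < t"
  then have "\<bar>heat_semigroup h t u j\<bar> \<le> N"
    by (intro heat_semigroup_abs_le[where u = u, OF assms(1) _ assms(4)]) simp
  then show "\<bar>heat_semigroup h t u j - u j\<bar> \<le> 2 * N * t powr 0"
    using assms(4)[of j] \<open>1 < t\<close> by simp
qed (use assms in auto)

text \<open>Subtracting the integrals requires both of them to converge; without that, the Lebesgue integral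
  would take the default value \<open>0\<close>.\<close>

lemma frac_laplacian_diff:
  assumes "0 < h" "0 < s" "s < 1" "\<And>i. \<bar>u i\<bar> \<le> N"
  shows "frac_laplacian h s u j - frac_laplacian h s u i =
    1 / Gamma (- s) * (LINT t:{0<..}|lborel.
      ((heat_semigroup h t u j - u j) - (heat_semigroup h t u i - u i)) / t powr (1 + s))"
  unfolding frac_laplacian_def right_diff_distrib[symmetric] diff_divide_distrib[of "_ - _" "_ - _"]
  by (subst set_integral_diff(2)) (use frac_laplacian_integrable[where u = u, OF assms] in auto)

lemma frac_laplacian_D_plus:
  assumes "0 < h" "0 < s" "s < 1" "\<And>i. \<bar>u i\<bar> \<le> N"
  shows "frac_laplacian h s (D_plus h u) j = D_plus h (frac_laplacian h s u) j"
proof -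
  let ?w = "\<lambda>t k. heat_semigroup h t u k - u k"
  have "frac_laplacian h s (D_plus h u) j =
      1 / Gamma (- s) * (LINT t:{0<..}|lborel. 1 / h * ((?w t (j + 1) - ?w t j) / t powr (1 + s)))"
    unfolding frac_laplacian_def
    by (intro arg_cong2[where f = "(*)"] set_lebesgue_integral_cong)
       (use heat_semigroup_D_plus[where u = u, OF assms(1) _ assms(4)] assms(1) in
         \<open>auto simp: D_plus_def field_simps\<close>)
  also have "\<dots> = (frac_laplacian h s u (j + 1) - frac_laplacian h s u j) / h"
    unfolding frac_laplacian_diff[where u = u, OF assms] set_integral_mult_right by simp
  finally show ?thesis by (simp add: D_plus_def)
qed

text \<open>The times before and after \<open>t = 1\<close> are treated separately, by the regularity of \<open>u\<close> and by its
  size respectively. A fixed threshold gives a bound that is uniform in \<open>h\<close>.\<close>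

lemma frac_laplacian_abs_le:
  assumes "0 < h" "0 < s" "\<And>i. \<bar>u i\<bar> \<le> N" "2 * s < \<alpha>" "\<alpha> \<le> 2"
    and "\<And>x. \<bar>u (j + x) + u (j - x) - 2 * u j\<bar> \<le> A * (h * \<bar>real_of_int x\<bar>) powr \<alpha>"
  shows "\<bar>frac_laplacian h s u j\<bar> \<le>
    \<bar>1 / Gamma (- s)\<bar> * (5 / 2 * A / (\<alpha> / 2 - s) + 2 * N / s)"
proof -
  have "\<bar>LINT t:{0<..}|lborel. (heat_semigroup h t u j - u j) / t powr (1 + s)\<bar> \<le>
      5 / 2 * A * 1 powr (\<alpha> / 2 - s) / (\<alpha> / 2 - s) + 2 * N * 1 powr (0 - s) / (s - 0)"
  proof (rule fractional_integral_bound(2))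
    show "set_borel_measurable lborel {0<..} (\<lambda>t. heat_semigroup h t u j - u j)"
      by (rule set_borel_measurable_increment[where u = u, OF assms(1,3)])
    show "\<bar>heat_semigroup h t u j - u j\<bar> \<le> 5 / 2 * A * t powr (\<alpha> / 2)" if "0 < t" for t
      by (rule heat_semigroup_increment_le[where u = u, OF assms(1) that assms(3) _ assms(5,6)])
         (use assms in linarith)
    show "\<bar>heat_semigroup h t u j - u j\<bar> \<le> 2 * N * t powr 0" if "1 < t" for t
      using heat_semigroup_abs_le[where u = u, OF assms(1) _ assms(3), of t j] assms(3)[of j] that by simp
  qed (use assms in auto)
  then show ?thesis
    unfolding frac_laplacian_def abs_mult by (intro mult_left_mono) simp_all
qed

text \<open>The threshold between small and large times is \<open>r\<^sup>2\<close>, where \<open>r\<close> is the distance of the two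
  mesh points: this is the time that diffusion needs to travel from one to the other. Smoothness
  of order \<open>a\<close> is used before it, and after it the gain of \<open>r powr (a - b)\<close> from comparing two points
  at distance \<open>r\<close>. Both contributions are then proportional to \<open>r powr (a - 2 * s)\<close>.\<close>

lemma frac_laplacian_diff_le:
  assumes "0 < h" "0 < s" "s < 1" "\<And>i. \<bar>u i\<bar> \<le> N" "j \<noteq> i"
    and "b < 2 * s" "2 * s < a"
    and "\<And>t. 0 < t \<Longrightarrow> \<bar>(heat_semigroup h t u j - u j) - (heat_semigroup h t u i - u i)\<bar> \<le> A * t powr (a / 2)"
    and "\<And>t. 0 < t \<Longrightarrow> \<bar>(heat_semigroup h t u j - u j) - (heat_semigroup h t u i - u i)\<bar> \<le>
           B * (h * \<bar>real_of_int (j - i)\<bar>) powr (a - b) * t powr (b / 2)"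
  shows "\<bar>frac_laplacian h s u j - frac_laplacian h s u i\<bar> \<le>
    \<bar>1 / Gamma (- s)\<bar> * (A / (a / 2 - s) + B / (s - b / 2)) * (h * \<bar>real_of_int (j - i)\<bar>) powr (a - 2 * s)"
proof -
  define r where "r = h * \<bar>real_of_int (j - i)\<bar>"
  have r: "0 < r" using assms(1,5) unfolding r_def by simp
  have rr: "(r\<^sup>2) powr e = r powr (2 * e)" for e
    using r by (simp add: powr_powr flip: powr_numeral)
  have "\<bar>LINT t:{0<..}|lborel.
      ((heat_semigroup h t u j - u j) - (heat_semigroup h t u i - u i)) / t powr (1 + s)\<bar> \<le>
      A * (r\<^sup>2) powr (a / 2 - s) / (a / 2 - s) +
      B * r powr (a - b) * (r\<^sup>2) powr (b / 2 - s) / (s - b / 2)"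
  proof (rule fractional_integral_bound(2))
    show "set_borel_measurable lborel {0<..}
        (\<lambda>t. (heat_semigroup h t u j - u j) - (heat_semigroup h t u i - u i))"
      using set_borel_measurable_increment[where u = u, OF assms(1,4), of j]
        set_borel_measurable_increment[where u = u, OF assms(1,4), of i]
      unfolding set_borel_measurable_def scaleR_right_diff_distrib
      by (rule borel_measurable_diff)
    show "\<bar>(heat_semigroup h t u j - u j) - (heat_semigroup h t u i - u i)\<bar> \<le> A * t powr (a / 2)"
      if "0 < t" for t by (rule assms(8)[OF that])
    show "\<bar>(heat_semigroup h t u j - u j) - (heat_semigroup h t u i - u i)\<bar> \<le>
        B * r powr (a - b) * t powr (b / 2)" if "r\<^sup>2 < t" for t
      unfolding r_def using that by (intro assms(9)) (smt (verit) zero_le_power2)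
  qed (use assms r in auto)
  also have "\<dots> = (A / (a / 2 - s) + B / (s - b / 2)) * r powr (a - 2 * s)"
  proof -
    have "r powr (a - b) * r powr (2 * (b / 2 - s)) = r powr (a - 2 * s)"
      unfolding powr_add[symmetric] by (rule arg_cong[where f = "\<lambda>e. r powr e"]) (simp add: algebra_simps)
    moreover have "r powr (2 * (a / 2 - s)) = r powr (a - 2 * s)"
      by (rule arg_cong[where f = "\<lambda>e. r powr e"]) (simp add: algebra_simps)
    ultimately show ?thesis
      unfolding rr mult.assoc by (simp only: distrib_right times_divide_eq_left mult.assoc)
  qed
  finally have "\<bar>1 / Gamma (- s)\<bar> * \<bar>LINT t:{0<..}|lborel.
      ((heat_semigroup h t u j - u j) - (heat_semigroup h t u i - u i)) / t powr (1 + s)\<bar> \<le>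
      \<bar>1 / Gamma (- s)\<bar> * ((A / (a / 2 - s) + B / (s - b / 2)) * r powr (a - 2 * s))"
    by (rule mult_left_mono) simp
  then show ?thesis
    unfolding frac_laplacian_diff[where u = u, OF assms(1-4)] abs_mult r_def by (simp only: mult.assoc)
qed

section \<open>Hoelder estimates with explicit constants\<close>

lemma lipschitz_of_D_plus_le:
  assumes "0 < h" "\<And>n. \<bar>D_plus h w n\<bar> \<le> B"
  shows "\<bar>w j - w i\<bar> \<le> B * (h * \<bar>real_of_int (j - i)\<bar>)"
proof -
  have step: "\<bar>w (n + 1) - w n\<bar> \<le> B * h" for n
    using assms(2)[of n] assms(1) by (simp add: D_plus_def abs_divide field_simps)
  have "\<bar>w (i + int k) - w i\<bar> \<le> B * h * real k" for i k
  proof (induction k)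
    case (Suc k)
    then show ?case using step[of "i + int k"] by (simp add: algebra_simps)
  qed simp
  from this[of i "nat (j - i)"] this[of j "nat (i - j)"] show ?thesis
    by (cases "i \<le> j") (simp_all add: abs_minus_commute mult.assoc)
qed

text \<open>A single constant for the supremum and the Hoelder seminorm, which avoids suprema in the
  estimates.\<close>

definition holder_bound :: "real \<Rightarrow> real \<Rightarrow> real \<Rightarrow> (int \<Rightarrow> real) \<Rightarrow> bool" where
  "holder_bound h \<alpha> N u \<longleftrightarrow>
     (\<forall>j. \<bar>u j\<bar> \<le> N) \<and> (\<forall>j i. \<bar>u j - u i\<bar> \<le> N * (h * \<bar>real_of_int (j - i)\<bar>) powr \<alpha>)"

lemma holder_boundD:
  assumes "holder_bound h \<alpha> N u"
  shows "\<bar>u j\<bar> \<le> N" "\<bar>u j - u i\<bar> \<le> N * (h * \<bar>real_of_int (j - i)\<bar>) powr \<alpha>" "0 \<le> N"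
  using assms abs_ge_zero[of "u 0"] order_trans[of 0 "\<bar>u 0\<bar>" N] unfolding holder_bound_def by auto

lemma holder_bound_mono:
  assumes "holder_bound h \<alpha> N u" "N \<le> M"
  shows "holder_bound h \<alpha> M u"
  using assms(1) unfolding holder_bound_def
  by (meson assms(2) mult_right_mono order_trans powr_ge_zero)

text \<open>Up to distance \<open>1\<close> the Lipschitz bound gives the estimate, beyond it the uniform bound.\<close>

lemma holder_bound_of_lipschitz:
  assumes "0 < h" "0 < \<beta>" "\<beta> \<le> 1" "\<And>j. \<bar>u j\<bar> \<le> N" "\<And>j. \<bar>D_plus h u j\<bar> \<le> N"
  shows "holder_bound h \<beta> (2 * N) u"
  unfolding holder_bound_def
proof (intro conjI allI)
  have N: "0 \<le> N" using assms(4)[of 0] by linarith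
  show "\<bar>u j\<bar> \<le> 2 * N" for j using assms(4)[of j] N by linarith
  fix j i
  let ?r = "h * \<bar>real_of_int (j - i)\<bar>"
  have r: "0 \<le> ?r" using assms(1) by simp
  show "\<bar>u j - u i\<bar> \<le> 2 * N * ?r powr \<beta>"
  proof (cases "?r \<le> 1")
    case True
    have "\<bar>u j - u i\<bar> \<le> N * ?r"
      by (rule lipschitz_of_D_plus_le[OF assms(1,5)])
    also have "\<dots> \<le> N * ?r powr \<beta>"
    proof (rule mult_left_mono[OF _ N])
      show "?r \<le> ?r powr \<beta>"
      proof (cases "?r = 0")
        case False
        then have "?r powr 1 \<le> ?r powr \<beta>" using True r assms by (intro powr_mono') auto
        then show ?thesis using r by (simp only: powr_one)
      qed (simp only: powr_ge_zero)
    qed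
    also have "\<dots> \<le> 2 * N * ?r powr \<beta>" using N by (intro mult_right_mono) auto
    finally show ?thesis .
  next
    case False
    then have "1 \<le> ?r powr \<beta>" using assms(2) by (intro ge_one_powr_ge_zero) auto
    then have "2 * N * 1 \<le> 2 * N * ?r powr \<beta>" using N by (intro mult_left_mono) auto
    then show ?thesis using assms(4)[of j] assms(4)[of i] by linarith
  qed
qed

lemma heat_semigroup_increment_le_holder:
  assumes "0 < h" "0 < t" "0 < \<beta>" "\<beta> \<le> 1" "holder_bound h \<beta> N u"
  shows "\<bar>heat_semigroup h t u j - u j\<bar> \<le> 5 * N * t powr (\<beta> / 2)"
proof -
  have "\<bar>u (j + x) + u (j - x) - 2 * u j\<bar> \<le> 2 * N * (h * \<bar>real_of_int x\<bar>) powr \<beta>" for x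
    using holder_boundD(2)[OF assms(5), of "j + x" j] holder_boundD(2)[OF assms(5), of "j - x" j]
    by simp
  from heat_semigroup_increment_le[where u = u, OF assms(1,2) holder_boundD(1)[OF assms(5)] assms(3) _ this]
  show ?thesis using assms(4) by simp
qed

text \<open>In \<open>frac_laplacian_diff_le\<close> take \<open>a = \<beta>\<close> and \<open>b = 0\<close>: for large times, the semigroup does not
  increase the oscillation \<open>N * r powr \<beta>\<close> of \<open>u\<close> between two points at distance \<open>r\<close>.\<close>

lemma frac_laplacian_holder_bound:
  assumes "0 < \<beta>" "\<beta> \<le> 1" "0 < s" "2 * s < \<beta>"
  obtains C where "0 < C"
    "\<And>h u N. 0 < h \<Longrightarrow> holder_bound h \<beta> N u \<Longrightarrow>
       holder_bound h (\<beta> - 2 * s) (C * N) (frac_laplacian h s u)"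
proof -
  define c where "c = \<bar>1 / Gamma (- s)\<bar>"
  \<comment> \<open>The summand \<open>1\<close> makes \<open>C\<close> positive whatever the value of \<open>c\<close>.\<close>
  define C where "C = c * (10 / (\<beta> / 2 - s) + 2 / s) + 1"
  have c: "0 \<le> c" unfolding c_def by simp
  have C: "0 < C" unfolding C_def using c assms by (intro add_nonneg_pos mult_nonneg_nonneg add_nonneg_nonneg) auto
  have "holder_bound h (\<beta> - 2 * s) (C * N) (frac_laplacian h s u)"
    if h: "0 < h" and u: "holder_bound h \<beta> N u" for h u N
    unfolding holder_bound_def
  proof (intro conjI allI)
    note ub = holder_boundD(1)[OF u] and uh = holder_boundD(2)[OF u] and N = holder_boundD(3)[OF u]
    show "\<bar>frac_laplacian h s u j\<bar> \<le> C * N" for j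
    proof -
      have "\<bar>u (j + x) + u (j - x) - 2 * u j\<bar> \<le> 2 * N * (h * \<bar>real_of_int x\<bar>) powr \<beta>" for x
        using uh[of "j + x" j] uh[of "j - x" j] by simp
      from frac_laplacian_abs_le[where u = u, OF h assms(3) ub assms(4) _ this]
      have "\<bar>frac_laplacian h s u j\<bar> \<le> c * (5 / 2 * (2 * N) / (\<beta> / 2 - s) + 2 * N / s)"
        using assms(2) unfolding c_def by simp
      also have "\<dots> = c * (5 / (\<beta> / 2 - s) + 2 / s) * N"
        by (simp add: distrib_right)
      also have "\<dots> \<le> C * N"
        unfolding C_def using c assms N
        by (intro mult_right_mono add_increasing2 mult_left_mono add_right_mono divide_right_mono) auto
      finally show ?thesis .
    qed
    fix j i
    let ?r = "h * \<bar>real_of_int (j - i)\<bar>"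
    show "\<bar>frac_laplacian h s u j - frac_laplacian h s u i\<bar> \<le> C * N * ?r powr (\<beta> - 2 * s)"
    proof (cases "j = i")
      case False
      have "\<bar>frac_laplacian h s u j - frac_laplacian h s u i\<bar> \<le>
          c * (10 * N / (\<beta> / 2 - s) + 2 * N / (s - 0 / 2)) * ?r powr (\<beta> - 2 * s)"
        unfolding c_def
      proof (rule frac_laplacian_diff_le[where u = u, OF h assms(3) _ ub False])
        fix t :: real assume t: "0 < t"
        show "\<bar>(heat_semigroup h t u j - u j) - (heat_semigroup h t u i - u i)\<bar> \<le> 10 * N * t powr (\<beta> / 2)"
          using heat_semigroup_increment_le_holder[OF h t assms(1,2) u, of j]
            heat_semigroup_increment_le_holder[OF h t assms(1,2) u, of i] by linarith
        have "\<bar>heat_semigroup h t u j - heat_semigroup h t u i\<bar> \<le> N * ?r powr \<beta>"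
          using uh[of "j - x" "i - x" for x] by (intro heat_semigroup_diff_le[where u = u, OF h t ub]) simp
        then show "\<bar>(heat_semigroup h t u j - u j) - (heat_semigroup h t u i - u i)\<bar> \<le>
            2 * N * ?r powr (\<beta> - 0) * t powr (0 / 2)"
          using uh[of j i] t by simp
      qed (use assms in auto)
      also have "\<dots> = c * (10 / (\<beta> / 2 - s) + 2 / s) * N * ?r powr (\<beta> - 2 * s)"
        by (simp add: distrib_right)
      also have "\<dots> \<le> C * N * ?r powr (\<beta> - 2 * s)"
        unfolding C_def using N by (intro mult_right_mono) auto
      finally show ?thesis .
    qed simp
  qed
  with C that show thesis by blast
qed

text \<open>The symmetric second difference is the increment of \<open>w n = u (n + x) - u n\<close> from \<open>j - x\<close> to \<open>j\<close>,
  and the slope of \<open>w\<close> is an increment of the slope of \<open>u\<close>.\<close>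

lemma second_difference_le:
  assumes "0 < h" "\<And>j i. \<bar>D_plus h u j - D_plus h u i\<bar> \<le> N * (h * \<bar>real_of_int (j - i)\<bar>) powr \<beta>"
  shows "\<bar>u (j + x) + u (j - x) - 2 * u j\<bar> \<le> N * (h * \<bar>real_of_int x\<bar>) powr (\<beta> + 1)"
proof -
  let ?r = "h * \<bar>real_of_int x\<bar>"
  define w where "w = (\<lambda>n. u (n + x) - u n)"
  have "D_plus h w n = D_plus h u (n + x) - D_plus h u n" for n
    unfolding w_def D_plus_def diff_divide_distrib[symmetric] by (simp add: algebra_simps)
  then have "\<bar>D_plus h w n\<bar> \<le> N * ?r powr \<beta>" for n
    using assms(2)[of "n + x" n] by simp
  from lipschitz_of_D_plus_le[OF assms(1) this, of j "j - x"]
  have "\<bar>u (j + x) + u (j - x) - 2 * u j\<bar> \<le> N * ?r powr \<beta> * ?r"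
    unfolding w_def by simp
  also have "\<dots> = N * ?r powr (\<beta> + 1)"
    using assms(1) by (simp add: powr_add)
  finally show ?thesis .
qed

text \<open>In \<open>frac_laplacian_diff_le\<close> take \<open>a = \<beta> + 1\<close> and \<open>b = \<beta>\<close>. For small times the second
  differences of \<open>u\<close> are of order \<open>\<beta> + 1\<close>. For large times \<open>w = e\<^sup>t\<^sup>\<Delta> u - u\<close> has the slope
  \<open>e\<^sup>t\<^sup>\<Delta> v - v\<close> with \<open>v = D\<^sub>+ u\<close>, which is of size \<open>t powr (\<beta> / 2)\<close>; this is integrable at
  infinity against \<open>t powr (- 1 - s)\<close> because \<open>\<beta> < 2 * s\<close>.\<close>

lemma frac_laplacian_holder_bound_of_D_plus:
  assumes "0 < \<beta>" "\<beta> \<le> 1" "0 < s" "s < 1" "\<beta> < 2 * s" "2 * s < 1 + \<beta>"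
  obtains C where "0 < C"
    "\<And>h u N. 0 < h \<Longrightarrow> (\<And>j. \<bar>u j\<bar> \<le> N) \<Longrightarrow> holder_bound h \<beta> N (D_plus h u) \<Longrightarrow>
       holder_bound h (\<beta> - 2 * s + 1) (C * N) (frac_laplacian h s u)"
proof -
  define c where "c = \<bar>1 / Gamma (- s)\<bar>"
  define a where "a = \<beta> + 1"
  have a: "0 < a" "a \<le> 2" "2 * s < a" using assms unfolding a_def by auto
  define C1 where "C1 = c * (5 / 2 / (a / 2 - s) + 2 / s)"
  define C2 where "C2 = c * (5 / (a / 2 - s) + 5 / (s - \<beta> / 2))"
  \<comment> \<open>\<open>C1\<close> bounds the supremum and \<open>C2\<close> the Hoelder quotients; the summand \<open>1\<close> ensures that
     \<open>C\<close> is positive.\<close>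
  define C where "C = C1 + C2 + 1"
  have c: "0 \<le> c" unfolding c_def by simp
  have C12: "0 \<le> C1" "0 \<le> C2" unfolding C1_def C2_def using c assms a by auto
  then have C: "0 < C" unfolding C_def by linarith
  have "holder_bound h (\<beta> - 2 * s + 1) (C * N) (frac_laplacian h s u)"
    if h: "0 < h" and ub: "\<And>j. \<bar>u j\<bar> \<le> N" and v: "holder_bound h \<beta> N (D_plus h u)" for h u N
    unfolding holder_bound_def
  proof (intro conjI allI)
    note vb = holder_boundD(1)[OF v] and vh = holder_boundD(2)[OF v] and N = holder_boundD(3)[OF v]
    have sd: "\<bar>u (j + x) + u (j - x) - 2 * u j\<bar> \<le> N * (h * \<bar>real_of_int x\<bar>) powr a" for j x
      unfolding a_def by (rule second_difference_le[OF h vh])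
    show "\<bar>frac_laplacian h s u j\<bar> \<le> C * N" for j
    proof -
      have "\<bar>frac_laplacian h s u j\<bar> \<le> c * (5 / 2 * N / (a / 2 - s) + 2 * N / s)"
        unfolding c_def by (rule frac_laplacian_abs_le[where u = u, OF h assms(3) ub a(3,2) sd])
      also have "\<dots> = C1 * N"
        unfolding C1_def by (simp add: distrib_right)
      also have "\<dots> \<le> C * N"
        unfolding C_def using C12 N by (intro mult_right_mono) auto
      finally show ?thesis .
    qed
    fix j i
    let ?r = "h * \<bar>real_of_int (j - i)\<bar>"
    show "\<bar>frac_laplacian h s u j - frac_laplacian h s u i\<bar> \<le> C * N * ?r powr (\<beta> - 2 * s + 1)"
    proof (cases "j = i")
      case False
      have "\<bar>frac_laplacian h s u j - frac_laplacian h s u i\<bar> \<le>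
          c * (5 * N / (a / 2 - s) + 5 * N / (s - \<beta> / 2)) * ?r powr (a - 2 * s)"
        unfolding c_def
      proof (rule frac_laplacian_diff_le[where u = u, OF h assms(3,4) ub False assms(5) a(3)])
        fix t :: real assume t: "0 < t"
        let ?w = "\<lambda>n. heat_semigroup h t u n - u n"
        have "\<bar>?w k\<bar> \<le> 5 / 2 * N * t powr (a / 2)" for k
          by (rule heat_semigroup_increment_le[where u = u, OF h t ub a(1,2) sd])
        from this[of j] this[of i]
        show "\<bar>?w j - ?w i\<bar> \<le> 5 * N * t powr (a / 2)" by linarith
        have "D_plus h ?w n = heat_semigroup h t (D_plus h u) n - D_plus h u n" for n
          unfolding heat_semigroup_D_plus[where u = u, OF h t ub] by (simp add: D_plus_def diff_divide_distrib)
        then have "\<bar>D_plus h ?w n\<bar> \<le> 5 * N * t powr (\<beta> / 2)" for n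
          using heat_semigroup_increment_le_holder[OF h t assms(1,2) v, of n] by simp
        from lipschitz_of_D_plus_le[OF h this, of j i]
        have "\<bar>?w j - ?w i\<bar> \<le> 5 * N * t powr (\<beta> / 2) * ?r" .
        moreover have "?r powr (a - \<beta>) = ?r" using h by (simp add: a_def)
        ultimately show "\<bar>?w j - ?w i\<bar> \<le> 5 * N * ?r powr (a - \<beta>) * t powr (\<beta> / 2)"
          by (simp only: mult_ac)
      qed
      also have "\<dots> = C2 * N * ?r powr (a - 2 * s)"
        unfolding C2_def by (simp add: distrib_right)
      also have "\<dots> \<le> C * N * ?r powr (a - 2 * s)"
        unfolding C_def using C12 N by (intro mult_right_mono) auto
      also have "a - 2 * s = \<beta> - 2 * s + 1" unfolding a_def by simp
      finally show ?thesis .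
    qed simp
  qed
  with C that show thesis by blast
qed

section \<open>Commutation with difference operators\<close>

lemma frac_laplacian_bounded:
  assumes "0 < h" "0 < s" "s < 1" "\<And>i. \<bar>u i\<bar> \<le> N"
  obtains M where "\<And>j. \<bar>frac_laplacian h s u j\<bar> \<le> M"
proof -
  have "\<bar>frac_laplacian h s u j\<bar> \<le>
      \<bar>1 / Gamma (- s)\<bar> * (5 / 2 * (4 * N / h\<^sup>2) / (2 / 2 - s) + 2 * N / s)" for j
    by (rule frac_laplacian_abs_le[where u = u, OF assms(1,2,4) _ _
          second_difference_le_of_bounded[where u = u, OF assms(1,4)]]) (use assms in auto)
  then show thesis by (rule that)
qed

text \<open>Reduces every statement about backward differences to forward differences and translations.\<close>

lemma D_minus_eq_D_plus_shift: "D_minus h u = D_plus h (\<lambda>j. u (j - 1))"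
  by (simp add: fun_eq_iff D_minus_def D_plus_def)

lemma frac_laplacian_shift:
  assumes "0 < h" "\<And>i. \<bar>u i\<bar> \<le> N"
  shows "frac_laplacian h s (\<lambda>j. u (j - 1)) j = frac_laplacian h s u (j - 1)"
proof -
  have "heat_semigroup h t (\<lambda>j. u (j - 1)) j = heat_semigroup h t u (j - 1)" if "0 < t" for t
    using heat_semigroup_eq_expectation[where u = u, OF assms(1) that assms(2), of "j - 1"]
      heat_semigroup_eq_expectation[where u = "\<lambda>j. u (j - 1)", OF assms(1) that assms(2), of j]
    by (simp add: algebra_simps)
  then show ?thesis
    unfolding frac_laplacian_def
    by (intro arg_cong2[where f = "(*)"] set_lebesgue_integral_cong) auto
qed

lemma frac_laplacian_D_minus:
  assumes "0 < h" "0 < s" "s < 1" "\<And>i. \<bar>u i\<bar> \<le> N"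
  shows "frac_laplacian h s (D_minus h u) = D_minus h (frac_laplacian h s u)"
  unfolding D_minus_eq_D_plus_shift fun_eq_iff
    frac_laplacian_D_plus[where u = "\<lambda>j. u (j - 1)", OF assms(1-3) assms(4)]
  by (simp add: D_plus_def frac_laplacian_shift[where u = u, OF assms(1,4)])

lemma D_plus_bounded:
  assumes "\<exists>N. \<forall>i. \<bar>u i\<bar> \<le> N"
  shows "\<exists>N. \<forall>i. \<bar>D_plus h u i\<bar> \<le> N"
proof -
  obtain N where N: "\<And>i. \<bar>u i\<bar> \<le> N" using assms by blast
  have "\<bar>D_plus h u i\<bar> \<le> 2 * N / \<bar>h\<bar>" for i
    using N[of i] N[of "i + 1"] unfolding D_plus_def abs_divide
    by (intro divide_right_mono) auto
  then show ?thesis by blast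
qed

lemma D_mixed_bounded:
  assumes "\<exists>N. \<forall>i. \<bar>u i\<bar> \<le> N"
  shows "\<exists>N. \<forall>i. \<bar>D_mixed h \<gamma> \<eta> u i\<bar> \<le> N"
proof -
  have m: "\<exists>N. \<forall>i. \<bar>(D_minus h ^^ \<eta>) u i\<bar> \<le> N" 
  proof (induction \<eta>)
    case (Suc \<eta>)
    then have "\<exists>N. \<forall>i. \<bar>(D_minus h ^^ \<eta>) u (i - 1)\<bar> \<le> N" by blast
    from D_plus_bounded[OF this, of h] show ?case
      by (simp only: funpow.simps comp_apply D_minus_eq_D_plus_shift[of h "(D_minus h ^^ \<eta>) u"])
  qed (use assms in simp)
  show ?thesis unfolding D_mixed_def
    by (induction \<gamma>) (use m D_plus_bounded in auto)
qed

lemma frac_laplacian_D_mixed: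
  assumes "0 < h" "0 < s" "s < 1" "\<exists>N. \<forall>i. \<bar>u i\<bar> \<le> N"
  shows "frac_laplacian h s (D_mixed h \<gamma> \<eta> u) = D_mixed h \<gamma> \<eta> (frac_laplacian h s u)"
proof -
  have minus: "frac_laplacian h s ((D_minus h ^^ \<eta>) u) = (D_minus h ^^ \<eta>) (frac_laplacian h s u)"
  proof (induction \<eta>)
    case (Suc \<eta>)
    obtain N where N: "\<And>i. \<bar>(D_minus h ^^ \<eta>) u i\<bar> \<le> N"
      using D_mixed_bounded[OF assms(4), of h 0 \<eta>] by (auto simp: D_mixed_def)
    show ?case
      using frac_laplacian_D_minus[where u = "(D_minus h ^^ \<eta>) u", OF assms(1-3) N] Suc by simp
  qed simp
  show ?thesis
  proof (induction \<gamma>)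
    case 0
    then show ?case using minus by (simp add: D_mixed_def)
  next
    case (Suc \<gamma>)
    obtain N where N: "\<And>i. \<bar>D_mixed h \<gamma> \<eta> u i\<bar> \<le> N"
      using D_mixed_bounded[OF assms(4)] by blast
    have "frac_laplacian h s (D_plus h (D_mixed h \<gamma> \<eta> u)) = D_plus h (frac_laplacian h s (D_mixed h \<gamma> \<eta> u))"
      by (rule ext) (rule frac_laplacian_D_plus[where u = "D_mixed h \<gamma> \<eta> u", OF assms(1-3) N])
    then show ?case using Suc by (simp add: D_mixed_def)
  qed
qed

section \<open>Norms and membership in the discrete Hoelder spaces\<close>

lemma holder_quotient_le_iff:
  assumes "0 < h" "m \<noteq> j"
  shows "holder_quotient h \<beta> v j m \<le> N \<longleftrightarrow> \<bar>v j - v m\<bar> \<le> N * (h * \<bar>real_of_int (j - m)\<bar>) powr \<beta>"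
proof -
  have "0 < h powr \<beta> * \<bar>real_of_int (j - m)\<bar> powr \<beta>" using assms by simp
  then show ?thesis
    using assms unfolding holder_quotient_def by (simp add: pos_divide_le_eq powr_mult)
qed

lemma bounded_holder_quotient:
  assumes "0 < h" "0 \<le> \<beta>" "\<exists>N. \<forall>i. \<bar>v i\<bar> \<le> N"
  shows "bdd_above ((\<lambda>(j, m). holder_quotient h \<beta> v j m) ` {(j, m). m \<noteq> j})"
proof -
  obtain N where N: "\<And>i. \<bar>v i\<bar> \<le> N" using assms(3) by blast
  have "holder_quotient h \<beta> v j m \<le> 2 * N / h powr \<beta>" if "m \<noteq> j" for j m
    unfolding holder_quotient_le_iff[OF assms(1) that]
  proof -
    have "1 \<le> \<bar>real_of_int (j - m)\<bar>" using that by linarith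
    then have "1 \<le> \<bar>real_of_int (j - m)\<bar> powr \<beta>" using assms(2) by (rule ge_one_powr_ge_zero)
    moreover have "0 \<le> N" using N[of 0] by linarith
    ultimately have "2 * N * 1 \<le> 2 * N * \<bar>real_of_int (j - m)\<bar> powr \<beta>" by (intro mult_left_mono) auto
    also have "\<dots> = 2 * N / h powr \<beta> * (h * \<bar>real_of_int (j - m)\<bar>) powr \<beta>"
      using assms(1) by (simp add: powr_mult)
    finally show "\<bar>v j - v m\<bar> \<le> 2 * N / h powr \<beta> * (h * \<bar>real_of_int (j - m)\<bar>) powr \<beta>"
      using N[of j] N[of m] by linarith
  qed
  then show ?thesis by (auto intro!: bdd_aboveI2)
qed

text \<open>Distinct mesh points are at distance at least \<open>h\<close>, so for fixed \<open>h\<close> boundedness already implies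
  Hoelder regularity of every order; only the constants carry information.\<close>

lemma bounded_in_holder_space:
  assumes "0 < h" "0 \<le> \<beta>" "\<exists>N. \<forall>i. \<bar>u i\<bar> \<le> N"
  shows "u \<in> holder_space h k \<beta>"
proof -
  have "bounded (range u)" using assms(3) by (auto simp: bounded_iff)
  then show ?thesis
    unfolding holder_space_def
    using bounded_holder_quotient[OF assms(1,2) D_mixed_bounded[OF assms(3)]] by auto
qed

lemma holder_space_bounded:
  assumes "u \<in> holder_space h k \<beta>"
  shows "\<exists>N. \<forall>i. \<bar>u i\<bar> \<le> N"
  using assms unfolding holder_space_def by (auto simp: bounded_iff)

lemma finite_pairs_le: "finite {(\<gamma>::nat, \<eta>::nat). \<gamma> + \<eta> \<le> k}"
  by (rule finite_subset[of _ "{..k} \<times> {..k}"]) auto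

lemma finite_pairs_eq: "finite {(\<gamma>::nat, \<eta>::nat). \<gamma> + \<eta> = k}"
  by (rule finite_subset[OF _ finite_pairs_le[of k]]) auto

lemma holder_seminorm_le:
  assumes "0 < h" "holder_bound h \<beta> N v"
  shows "holder_seminorm h \<beta> v \<le> N"
  unfolding holder_seminorm_def
proof (rule cSUP_least)
  show "{(j, m). m \<noteq> j} \<noteq> ({} :: (int \<times> int) set)" using zero_neq_one[where 'a = int] by blast
  show "(case x of (j, m) \<Rightarrow> holder_quotient h \<beta> v j m) \<le> N" if "x \<in> {(j, m). m \<noteq> j}" for x
    using that holder_quotient_le_iff[OF assms(1)] holder_boundD(2)[OF assms(2)] by auto
qed

text \<open>The factor \<open>2\<close> appears because the norm is the sum of two maxima, while a single constant
  bounds both of them.\<close>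
lemma holder_norm_le:
  assumes "0 < h"
    and "\<And>\<gamma> \<eta> m. \<gamma> + \<eta> \<le> k \<Longrightarrow> \<bar>D_mixed h \<gamma> \<eta> u m\<bar> \<le> N"
    and "\<And>\<gamma> \<eta>. \<gamma> + \<eta> = k \<Longrightarrow> holder_bound h \<beta> N (D_mixed h \<gamma> \<eta> u)"
  shows "holder_norm h k \<beta> u \<le> 2 * N"
proof -
  have "(MAX (\<gamma>, \<eta>)\<in>{(\<gamma>, \<eta>). \<gamma> + \<eta> \<le> k}. SUP m. \<bar>D_mixed h \<gamma> \<eta> u m\<bar>) \<le> N"
  proof (rule Max.boundedI)
    show "(\<lambda>(\<gamma>, \<eta>). SUP m. \<bar>D_mixed h \<gamma> \<eta> u m\<bar>) ` {(\<gamma>, \<eta>). \<gamma> + \<eta> \<le> k} \<noteq> {}"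
      using le0[of k] by (auto intro!: exI[of _ 0])
  qed (use finite_pairs_le assms(2) in \<open>auto intro!: cSUP_least\<close>)
  moreover have "(MAX (\<gamma>, \<eta>)\<in>{(\<gamma>, \<eta>). \<gamma> + \<eta> = k}. holder_seminorm h \<beta> (D_mixed h \<gamma> \<eta> u)) \<le> N"
  proof (rule Max.boundedI)
    show "(\<lambda>(\<gamma>, \<eta>). holder_seminorm h \<beta> (D_mixed h \<gamma> \<eta> u)) ` {(\<gamma>, \<eta>). \<gamma> + \<eta> = k} \<noteq> {}"
      by (auto intro: exI[of _ 0])
  qed (use finite_pairs_eq holder_seminorm_le[OF assms(1)] assms(3) in auto)
  ultimately show ?thesis unfolding holder_norm_def by linarith
qed

lemma le_holder_norm:
  assumes "0 < h" "0 \<le> \<beta>" "\<exists>N. \<forall>i. \<bar>u i\<bar> \<le> N"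
  shows "\<gamma> + \<eta> \<le> k \<Longrightarrow> \<bar>D_mixed h \<gamma> \<eta> u m\<bar> \<le> holder_norm h k \<beta> u"
    and "\<gamma> + \<eta> = k \<Longrightarrow> holder_bound h \<beta> (holder_norm h k \<beta> u) (D_mixed h \<gamma> \<eta> u)"
proof -
  define P where "P = (MAX (\<gamma>, \<eta>)\<in>{(\<gamma>, \<eta>). \<gamma> + \<eta> \<le> k}. SUP m. \<bar>D_mixed h \<gamma> \<eta> u m\<bar>)"
  define Q where "Q = (MAX (\<gamma>, \<eta>)\<in>{(\<gamma>, \<eta>). \<gamma> + \<eta> = k}. holder_seminorm h \<beta> (D_mixed h \<gamma> \<eta> u))"
  have norm: "holder_norm h k \<beta> u = P + Q" unfolding holder_norm_def P_def Q_def ..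
  have P: "\<bar>D_mixed h \<gamma> \<eta> u m\<bar> \<le> P" if "\<gamma> + \<eta> \<le> k" for \<gamma> \<eta> m
  proof -
    have "\<bar>D_mixed h \<gamma> \<eta> u m\<bar> \<le> (SUP m. \<bar>D_mixed h \<gamma> \<eta> u m\<bar>)"
      using D_mixed_bounded[OF assms(3), of h \<gamma> \<eta>] by (intro cSUP_upper) (auto intro: bdd_aboveI2)
    also have "\<dots> \<le> P"
      unfolding P_def using that finite_pairs_le by (intro Max_ge) force+
    finally show ?thesis .
  qed
  have quot: "holder_quotient h \<beta> (D_mixed h \<gamma> \<eta> u) j m \<le> Q" if "\<gamma> + \<eta> = k" "m \<noteq> j" for \<gamma> \<eta> j m
  proof -
    have "holder_quotient h \<beta> (D_mixed h \<gamma> \<eta> u) j m \<le> holder_seminorm h \<beta> (D_mixed h \<gamma> \<eta> u)"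
      unfolding holder_seminorm_def
      using cSUP_upper[OF _ bounded_holder_quotient[OF assms(1,2) D_mixed_bounded[OF assms(3)]],
          of "(j, m)"] that(2) by simp
    also have "\<dots> \<le> Q"
      unfolding Q_def using that(1) finite_pairs_eq by (intro Max_ge) force+
    finally show ?thesis .
  qed
  have P0: "0 \<le> P" using P[of 0 0 0] by (simp add: order_trans[OF abs_ge_zero])
  have "0 \<le> holder_quotient h \<beta> (D_mixed h k 0 u) 1 0" by (simp add: holder_quotient_def)
  then have Q0: "0 \<le> Q" using quot[of k 0 0 1] by simp
  show "\<bar>D_mixed h \<gamma> \<eta> u m\<bar> \<le> holder_norm h k \<beta> u" if "\<gamma> + \<eta> \<le> k"
    using P[OF that, of m] Q0 norm by linarith
  show "holder_bound h \<beta> (holder_norm h k \<beta> u) (D_mixed h \<gamma> \<eta> u)" if "\<gamma> + \<eta> = k"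
    unfolding holder_bound_def
  proof (intro conjI allI)
    show "\<bar>D_mixed h \<gamma> \<eta> u j\<bar> \<le> holder_norm h k \<beta> u" for j
      using P[of \<gamma> \<eta> j] Q0 norm that by linarith
    fix j i
    show "\<bar>D_mixed h \<gamma> \<eta> u j - D_mixed h \<gamma> \<eta> u i\<bar> \<le>
        holder_norm h k \<beta> u * (h * \<bar>real_of_int (j - i)\<bar>) powr \<beta>"
    proof (cases "j = i")
      case False
      then have "holder_quotient h \<beta> (D_mixed h \<gamma> \<eta> u) j i \<le> holder_norm h k \<beta> u"
        using quot[OF that, of i j] P0 norm by linarith
      then show ?thesis using holder_quotient_le_iff[OF assms(1)] False by metis
    qed simp
  qed
qed

section \<open>Hoelder estimates for the fractional Laplacian\<close>

theorem theorem1p5: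
  fixes \<beta> s :: real
  assumes "0 < \<beta>" and "\<beta> \<le> 1" and "0 < s" and "s < 1"
  shows
    "(2 * s < \<beta> \<longrightarrow>
       (\<exists>C>0. \<forall>h>0. \<forall>u\<in>holder_space h 0 \<beta>.
          frac_laplacian h s u \<in> holder_space h 0 (\<beta> - 2 * s) \<and>
          holder_norm h 0 (\<beta> - 2 * s) (frac_laplacian h s u) \<le> C * holder_norm h 0 \<beta> u)) \<and>
     (2 * s < \<beta> \<longrightarrow>
       (\<exists>C>0. \<forall>h>0. \<forall>u\<in>holder_space h 1 \<beta>.
          frac_laplacian h s u \<in> holder_space h 1 (\<beta> - 2 * s) \<and>
          holder_norm h 1 (\<beta> - 2 * s) (frac_laplacian h s u) \<le> C * holder_norm h 1 \<beta> u)) \<and>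
     (\<beta> < 2 * s \<and> 2 * s < 1 + \<beta> \<longrightarrow>
       (\<exists>C>0. \<forall>h>0. \<forall>u\<in>holder_space h 1 \<beta>.
          frac_laplacian h s u \<in> holder_space h 0 (\<beta> - 2 * s + 1) \<and>
          holder_norm h 0 (\<beta> - 2 * s + 1) (frac_laplacian h s u) \<le> C * holder_norm h 1 \<beta> u)) \<and>
     (\<forall>(k::nat) (l::nat) (\<gamma>::real).
        real k + \<beta> - 2 * s \<notin> \<int> \<and> 2 * s < real k + \<beta> \<and>
        int l = \<lfloor>real k + \<beta> - 2 * s\<rfloor> \<and> \<gamma> = real k + \<beta> - 2 * s - real l \<longrightarrow>
        (\<forall>h>0. \<forall>u\<in>holder_space h k \<beta>. frac_laplacian h s u \<in> holder_space h l \<gamma>))"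
proof -
  have mem: "frac_laplacian h s u \<in> holder_space h l \<gamma>"
    if h: "0 < h" and \<gamma>: "0 \<le> \<gamma>" and u: "u \<in> holder_space h k \<beta>" for h u k l and \<gamma> :: real
  proof -
    obtain N where "\<And>i. \<bar>u i\<bar> \<le> N" using holder_space_bounded[OF u] by blast
    from frac_laplacian_bounded[where u = u, OF h assms(3,4) this]
    show ?thesis using bounded_in_holder_space[OF h \<gamma>] by metis
  qed
  have D00: "D_mixed h 0 0 v = v" for h v by (simp add: D_mixed_def)
  have D10: "D_mixed h 1 0 v = D_plus h v" for h v by (simp add: D_mixed_def)
  have i: "\<exists>C>0. \<forall>h>0. \<forall>u\<in>holder_space h 0 \<beta>.
          frac_laplacian h s u \<in> holder_space h 0 (\<beta> - 2 * s) \<and>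
          holder_norm h 0 (\<beta> - 2 * s) (frac_laplacian h s u) \<le> C * holder_norm h 0 \<beta> u"
    if lt: "2 * s < \<beta>"
  proof -
    from frac_laplacian_holder_bound[OF assms(1,2,3) lt] obtain C where C: "0 < C"
      "\<And>h u N. 0 < h \<Longrightarrow> holder_bound h \<beta> N u \<Longrightarrow>
         holder_bound h (\<beta> - 2 * s) (C * N) (frac_laplacian h s u)" by blast
    have "holder_norm h 0 (\<beta> - 2 * s) (frac_laplacian h s u) \<le> 2 * C * holder_norm h 0 \<beta> u"
      if h: "0 < h" and u: "u \<in> holder_space h 0 \<beta>" for h u
    proof -
      have "holder_bound h \<beta> (holder_norm h 0 \<beta> u) u"
        using le_holder_norm(2)[OF h _ holder_space_bounded[OF u], of \<beta> 0 0 0] assms(1)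
        by (simp add: D00)
      note b = C(2)[OF h this]
      have "holder_norm h 0 (\<beta> - 2 * s) (frac_laplacian h s u) \<le> 2 * (C * holder_norm h 0 \<beta> u)"
        by (rule holder_norm_le[OF h]) (use b holder_boundD(1)[OF b] in \<open>auto simp: D00\<close>)
      then show ?thesis by simp
    qed
    then show ?thesis using C(1) mem lt by (intro exI[of _ "2 * C"]) auto
  qed
  have ii: "\<exists>C>0. \<forall>h>0. \<forall>u\<in>holder_space h 1 \<beta>.
          frac_laplacian h s u \<in> holder_space h 1 (\<beta> - 2 * s) \<and>
          holder_norm h 1 (\<beta> - 2 * s) (frac_laplacian h s u) \<le> C * holder_norm h 1 \<beta> u"
    if lt: "2 * s < \<beta>"
  proof -
    from frac_laplacian_holder_bound[OF assms(1,2,3) lt] obtain C where C: "0 < C"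
      "\<And>h u N. 0 < h \<Longrightarrow> holder_bound h \<beta> N u \<Longrightarrow>
         holder_bound h (\<beta> - 2 * s) (C * N) (frac_laplacian h s u)" by blast
    have "holder_norm h 1 (\<beta> - 2 * s) (frac_laplacian h s u) \<le> 4 * C * holder_norm h 1 \<beta> u"
      if h: "0 < h" and u: "u \<in> holder_space h 1 \<beta>" for h u
    proof -
      define N where "N = holder_norm h 1 \<beta> u"
      note bdd = holder_space_bounded[OF u]
      have sup: "\<bar>D_mixed h \<gamma> \<eta> u m\<bar> \<le> N" if "\<gamma> + \<eta> \<le> 1" for \<gamma> \<eta> m
        unfolding N_def using le_holder_norm(1)[OF h _ bdd that] assms(1) by simp
      have N: "0 \<le> N" using sup[of 0 0 0] by (simp add: order_trans[OF abs_ge_zero])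
      \<comment> \<open>The norm controls the Hoelder quotients of the first differences only; \<open>u\<close> itself is
         Lipschitz, which costs the factor \<open>2\<close>.\<close>
      have hol: "holder_bound h \<beta> (2 * N) (D_mixed h \<gamma> \<eta> u)" if "\<gamma> + \<eta> \<le> 1" for \<gamma> \<eta>
      proof (cases "\<gamma> + \<eta> = 1")
        case True
        have "holder_bound h \<beta> N (D_mixed h \<gamma> \<eta> u)"
          unfolding N_def using le_holder_norm(2)[OF h _ bdd True] assms(1) by simp
        then show ?thesis by (rule holder_bound_mono) (use N in simp)
      next
        case False
        then have "\<gamma> = 0" "\<eta> = 0" using that by auto
        then show ?thesis
          using holder_bound_of_lipschitz[OF h assms(1,2), of u N] sup[of 0 0] sup[of 1 0]
          by (simp add: D00 D10[unfolded One_nat_def])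
      qed
      have b: "holder_bound h (\<beta> - 2 * s) (C * (2 * N)) (D_mixed h \<gamma> \<eta> (frac_laplacian h s u))"
        if "\<gamma> + \<eta> \<le> 1" for \<gamma> \<eta>
        using C(2)[OF h hol[OF that]] by (simp only: frac_laplacian_D_mixed[OF h assms(3,4) bdd])
      have "holder_norm h 1 (\<beta> - 2 * s) (frac_laplacian h s u) \<le> 2 * (C * (2 * N))"
        using b holder_boundD(1)[OF b] by (intro holder_norm_le[OF h]) auto
      then show ?thesis unfolding N_def by simp
    qed
    then show ?thesis using C(1) mem lt by (intro exI[of _ "4 * C"]) auto
  qed
  have iii: "\<exists>C>0. \<forall>h>0. \<forall>u\<in>holder_space h 1 \<beta>.
          frac_laplacian h s u \<in> holder_space h 0 (\<beta> - 2 * s + 1) \<and>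
          holder_norm h 0 (\<beta> - 2 * s + 1) (frac_laplacian h s u) \<le> C * holder_norm h 1 \<beta> u"
    if lt: "\<beta> < 2 * s" "2 * s < 1 + \<beta>"
  proof -
    from frac_laplacian_holder_bound_of_D_plus[OF assms lt] obtain C where C: "0 < C"
      "\<And>h u N. 0 < h \<Longrightarrow> (\<And>j. \<bar>u j\<bar> \<le> N) \<Longrightarrow> holder_bound h \<beta> N (D_plus h u) \<Longrightarrow>
         holder_bound h (\<beta> - 2 * s + 1) (C * N) (frac_laplacian h s u)" by blast
    have "holder_norm h 0 (\<beta> - 2 * s + 1) (frac_laplacian h s u) \<le> 2 * C * holder_norm h 1 \<beta> u"
      if h: "0 < h" and u: "u \<in> holder_space h 1 \<beta>" for h u
    proof -
      note bdd = holder_space_bounded[OF u]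
      have "\<bar>u j\<bar> \<le> holder_norm h 1 \<beta> u" for j
        using le_holder_norm(1)[OF h _ bdd, of \<beta> 0 0 1 j] assms(1) by (simp add: D00)
      moreover have "holder_bound h \<beta> (holder_norm h 1 \<beta> u) (D_plus h u)"
        using le_holder_norm(2)[OF h _ bdd, of \<beta> 1 0 1] assms(1) by (simp only: D10)
      ultimately have b: "holder_bound h (\<beta> - 2 * s + 1) (C * holder_norm h 1 \<beta> u) (frac_laplacian h s u)"
        by (rule C(2)[OF h])
      have "holder_norm h 0 (\<beta> - 2 * s + 1) (frac_laplacian h s u) \<le> 2 * (C * holder_norm h 1 \<beta> u)"
        by (rule holder_norm_le[OF h]) (use b holder_boundD(1)[OF b] in \<open>auto simp: D00\<close>)
      then show ?thesis by simp
    qed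
    then show ?thesis using C(1) mem lt by (intro exI[of _ "2 * C"]) auto
  qed
  have iv: "frac_laplacian h s u \<in> holder_space h l \<gamma>"
    if "int l = \<lfloor>real k + \<beta> - 2 * s\<rfloor>" "\<gamma> = real k + \<beta> - 2 * s - real l" "0 < h" "u \<in> holder_space h k \<beta>"
    for h u k l \<gamma>
  proof (rule mem[OF that(3) _ that(4)])
    have "real l = of_int \<lfloor>real k + \<beta> - 2 * s\<rfloor>" using that(1) by (metis of_int_of_nat_eq)
    then show "0 \<le> \<gamma>" using that(2) of_int_floor_le[of "real k + \<beta> - 2 * s"] by linarith
  qed
  show ?thesis using i ii iii iv by blast
qed

end
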